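(* For $u\in S_0$ define $$\delta_1(u)=\left(\int_{\mathbb{R}^N}|\nabla u|^2dx\right)^{1/2}\left(\int_{\mathbb{R}^N}|u|^2|x|^2dx\right)^{1/2}-\frac N2\int_{\mathbb{R}^N}|u|^2dx,$$ $$d_2(u,F)=\inf_{c\in\mathbb{R},\,\vec d\in\mathbb{R}^N,\,\lambda\ne0}\left(\int_{\mathbb{R}^N}\left(\left|u-ce^{-\frac{|x|^2}{2\lambda^2}}\right|^2+\left|u-(c+\vec d\cdot x)e^{-\frac{|x|^2}{2\lambda^2}}\right|^2\right)dx\right)^{1/2},$$ and for a set $B\subset L^2(\mathbb{R}^N)$, $d_1(u,B)=\inf_{v\in B}\|u-v\|_{L^2(\mathbb{R}^N)}$. Let $E_{HUP}=\{\alpha e^{-\beta|x|^2}:\alpha\in\mathbb{R},\beta>0\}$ and $F=\{(\alpha+\vec\gamma\cdot x)e^{-\beta|x|^2}:\alpha\in\mathbb{R},\vec\gamma\in\mathbb{R}^N,\beta>0\}$. Then for all $u\in S_0$, $$\delta_1(u)\ge d_2^2(u,F),$$ and consequently $$\delta_1(u)-d_1^2(u,E_{HUP})\ge d_1^2(u,F).$$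
   Context: $S_0$ is the completion of $C_0^\infty(\mathbb{R}^N)$ under the norm $\left(\int_{\mathbb{R}^N}|\nabla u|^2dx\right)^{1/2}+\left(\int_{\mathbb{R}^N}|u|^2|x|^2dx\right)^{1/2}$. *)

theory Defs
  imports "HOL-Analysis.Analysis"
begin

coinductive smooth_fun :: "('a::euclidean_space \<Rightarrow> real) \<Rightarrow> bool" where
  "(\<forall>x. f differentiable (at x)) \<Longrightarrow>
   (\<forall>i\<in>Basis. smooth_fun (\<lambda>x. frechet_derivative f (at x) i)) \<Longrightarrow> smooth_fun f"

definition test_fun :: "('a::euclidean_space \<Rightarrow> real) \<Rightarrow> bool" where
  "test_fun \<phi> \<longleftrightarrow> smooth_fun \<phi> \<and> bounded {x. \<phi> x \<noteq> 0}"

text \<open>Realisation of the completion S_0: the element u of S_0 together with its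
  (weak) gradient G, obtained as limit of test functions in the S_0 norm.\<close>
definition in_S0 :: "('a::euclidean_space \<Rightarrow> real) \<Rightarrow> ('a \<Rightarrow> 'a) \<Rightarrow> bool" where
  "in_S0 u G \<longleftrightarrow>
     u \<in> borel_measurable lborel \<and> G \<in> borel_measurable lborel \<and>
     integrable lborel (\<lambda>x. (norm (G x))\<^sup>2) \<and>
     integrable lborel (\<lambda>x. (u x)\<^sup>2 * (norm x)\<^sup>2) \<and>
     (\<exists>\<phi> D\<phi>. (\<forall>n. test_fun (\<phi> n)) \<and>
        (\<forall>n x. (\<phi> n has_derivative (\<lambda>h. D\<phi> n x \<bullet> h)) (at x)) \<and>
        (\<lambda>n. \<integral>x. (norm (D\<phi> n x - G x))\<^sup>2 \<partial>lborel) \<longlonglongrightarrow> 0 \<and>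
        (\<lambda>n. \<integral>x. (\<phi> n x - u x)\<^sup>2 * (norm x)\<^sup>2 \<partial>lborel) \<longlonglongrightarrow> 0)"

definition delta1 :: "('a::euclidean_space \<Rightarrow> real) \<Rightarrow> ('a \<Rightarrow> 'a) \<Rightarrow> real" where
  "delta1 u G =
     sqrt (\<integral>x. (norm (G x))\<^sup>2 \<partial>lborel) * sqrt (\<integral>x. (u x)\<^sup>2 * (norm x)\<^sup>2 \<partial>lborel)
     - real DIM('a) / 2 * (\<integral>x. (u x)\<^sup>2 \<partial>lborel)"

definition d2F :: "('a::euclidean_space \<Rightarrow> real) \<Rightarrow> real" where
  "d2F u = Inf {sqrt (\<integral>x. (u x - c * exp (- (norm x)\<^sup>2 / (2 * lam\<^sup>2)))\<^sup>2
                     + (u x - (c + d \<bullet> x) * exp (- (norm x)\<^sup>2 / (2 * lam\<^sup>2)))\<^sup>2 \<partial>lborel)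
               | c d lam. lam \<noteq> (0::real)}"

definition d1 :: "('a::euclidean_space \<Rightarrow> real) \<Rightarrow> ('a \<Rightarrow> real) set \<Rightarrow> real" where
  "d1 u B = Inf {sqrt (\<integral>x. (u x - v x)\<^sup>2 \<partial>lborel) | v. v \<in> B}"

definition E_HUP :: "('a::euclidean_space \<Rightarrow> real) set" where
  "E_HUP = {(\<lambda>x. \<alpha> * exp (- \<beta> * (norm x)\<^sup>2)) | \<alpha> \<beta>. \<beta> > 0}"

definition F_set :: "('a::euclidean_space \<Rightarrow> real) set" where
  "F_set = {(\<lambda>x. (\<alpha> + \<gamma> \<bullet> x) * exp (- \<beta> * (norm x)\<^sup>2)) | \<alpha> \<gamma> \<beta>. \<beta> > 0}"

end

theory Submission
  imports Defs "HOL-Probability.Distributions"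
begin

text \<open>
  Write \<open>u = v exp (- k |x|\<^sup>2 / 2)\<close> and choose \<open>k\<close> to balance the two factors of the uncertainty
  product. Then \<open>delta1\<close> becomes \<open>1 / (2 k)\<close> times the Gaussian Dirichlet energy of \<open>v\<close>, and the claim is
  that the energy, \<open>\<Sum> n |v\<^sub>n|\<^sup>2\<close> in terms of the Hermite components of \<open>v\<close>, is at least
  \<open>|v\<^sub>1|\<^sup>2 + 2 \<Sum>\<^sub>n\<^sub>\<ge>\<^sub>2 |v\<^sub>n|\<^sup>2\<close>. No Hermite expansion is needed: for Gaussian vectors \<open>X\<close>, \<open>Y\<close> of
  correlation \<open>s\<close> let \<open>C(s) = E v(X) v(Y)\<close>. By Gaussian integration by parts the \<open>s\<close>-derivative of
  \<open>C\<close> is, up to a constant, the same expression for the gradient of \<open>v\<close>. All such expressions are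
  nonnegative, so \<open>C'\<close> is convex and the trapezoidal rule gives
  \<open>C(1) - C(0) \<le> (C'(0) + C'(1)) / 2\<close>, which is the claim. It passes from test functions to \<open>S_0\<close>
  by \<open>L\<^sup>2\<close> convergence.
\<close>

section \<open>Gaussian weights\<close>

text \<open>In Hermite terms, after normalisation, C(s) is the sum of s^n |v_n|^2, so C(0) =
  |v_0|^2, C'(0) = |v_1|^2 and C'(1) is the energy. The energy is thus at least 2 (C(1) - C(0)) -
  C'(0), which is the squared distance of u to its projection onto degree 0 plus that onto degree at
  most 1. These are the two terms of \<open>d2F\<close>, with the same c and the same Gaussian, so
  one inequality also gives the estimate for \<open>d1\<close>. Multiplication by exp (k |x|^2 / 2)
  is harmless for functions of bounded support but gives no control for a general element of S_0.
  The Gaussian inequality is therefore proved for the former only, and is restated through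
  quantities that are continuous in the S_0 norm before the limit is taken. Convexity of C' is the
  sign of C'''. Each differentiation of C leaves one more derivative on its arguments but uses two
  on the way; hence the order 4 below. The balancing k is the ratio of the two square roots. It
  degenerates when one of them is 0; that case is settled by showing that u then vanishes almost
  everywhere.\<close>

definition gauss :: "real \<Rightarrow> 'a::euclidean_space \<Rightarrow> real" where
  "gauss k x = exp (- k * (norm x)\<^sup>2)"

lemma gauss_pos: "0 < gauss k x"
  by (simp add: gauss_def)

lemma gauss_nonneg: "0 \<le> gauss k x"
  by (simp add: gauss_def)

lemma continuous_gauss: "continuous_on S (gauss k)"
  unfolding gauss_def by (intro continuous_intros)

lemma measurable_gauss [measurable]: "gauss k \<in> borel_measurable borel"
  by (rule borel_measurable_continuous_onI[OF continuous_gauss])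

lemma gauss_mult: "gauss k x * gauss l x = gauss (k + l) x"
  by (simp add: gauss_def exp_add[symmetric] algebra_simps)

lemma gauss_Pair: "gauss k (x, y) = gauss k x * gauss k y"
  by (simp add: gauss_def norm_Pair exp_add[symmetric] algebra_simps)

lemma norm_sq_Basis: "(norm x)\<^sup>2 = (\<Sum>i\<in>Basis. (x \<bullet> i)\<^sup>2)"
  unfolding power2_norm_eq_inner by (subst euclidean_inner) (simp add: power2_eq_square)

text \<open>The integral factors over the coordinates, and each factor is a multiple of the integral
  of a normal density.\<close>

lemma integrable_gauss:
  assumes "k > 0"
  shows "integrable lborel (gauss k :: 'a::euclidean_space \<Rightarrow> real)"
proof (rule integrableI_nonneg)
  \<comment> \<open>The standard deviation for which the normal density has exponent - k
    t^2.\<close>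
  define s where "s = 1 / sqrt (2 * k)"
  have s: "s > 0" "1 / (2 * s\<^sup>2) = k"
    using assms by (auto simp: s_def power_divide)
  have e1: "exp (- k * t\<^sup>2) = sqrt (2 * pi * s\<^sup>2) * normal_density 0 s t" for t
    unfolding normal_density_def using s(1) by (simp add: s(2)[symmetric])
  have "integrable lborel (\<lambda>t::real. exp (- k * t\<^sup>2))"
    unfolding e1 using s by (intro integrable_mult_right integrable_normal_density) auto
  then have fin: "(\<integral>\<^sup>+t. ennreal (exp (- k * (t::real)\<^sup>2)) \<partial>lborel) < \<infinity>"
    by (subst nn_integral_eq_integral) auto
  have "gauss k x = (\<Prod>b\<in>Basis. exp (- k * (x \<bullet> b)\<^sup>2))" for x :: 'a
    by (simp add: gauss_def norm_sq_Basis exp_sum[symmetric] sum_negf sum_distrib_left)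
  then have "(\<integral>\<^sup>+x. ennreal (gauss k (x::'a)) \<partial>lborel)
      = (\<integral>\<^sup>+x. (\<Prod>b\<in>Basis. ennreal (exp (- k * ((x::'a) \<bullet> b)\<^sup>2))) \<partial>lborel)"
    by (simp add: prod_ennreal)
  also have "\<dots> = (\<Prod>b\<in>(Basis::'a set). (\<integral>\<^sup>+t. ennreal (exp (- k * t\<^sup>2)) \<partial>lborel))"
    by (subst nn_integral_lborel_prod) auto
  also have "\<dots> < \<infinity>"
    using fin by (simp add: power_less_top_ennreal)
  finally show "(\<integral>\<^sup>+x. ennreal (gauss k (x::'a)) \<partial>lborel) < \<infinity>" .
qed (auto simp: gauss_nonneg)

lemma integral_gauss_pos:
  assumes "k > 0"
  shows "(\<integral>x. gauss k x \<partial>(lborel :: 'a::euclidean_space measure)) > 0"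
proof -
  have "(\<integral>x. gauss k x \<partial>(lborel :: 'a measure)) \<noteq> 0"
  proof
    assume "(\<integral>x. gauss k x \<partial>(lborel :: 'a measure)) = 0"
    then have "AE x in (lborel :: 'a measure). gauss k x = 0"
      using integrable_gauss[OF assms] by (subst (asm) integral_nonneg_eq_0_iff_AE) (auto simp: gauss_nonneg)
    then have "AE x in (lborel :: 'a measure). False"
      by eventually_elim (use gauss_pos in \<open>auto simp: less_le\<close>)
    then show False
      by (simp add: trivial_limit_def[symmetric] ae_filter_eq_bot_iff)
  qed
  moreover have "(\<integral>x. gauss k x \<partial>(lborel :: 'a measure)) \<ge> 0"
    by (simp add: gauss_nonneg)
  ultimately show ?thesis by linarith
qed

text \<open>Half of the exponent pays for the linear factor: for E = exp (k |x|^2 / 2) one has 1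
  \<le> E and |x|^2 \<le> (2 / k) E, while 1 + |x| \<le> 2 + |x|^2.\<close>

lemma norm_mult_gauss_le:
  assumes "k > 0"
  shows "(1 + norm x) * gauss k x \<le> (2 + 2 / k) * gauss (k / 2) x"
proof -
  let ?t = "(norm x)\<^sup>2" and ?E = "exp (k / 2 * (norm x)\<^sup>2)"
  have 1: "norm x \<le> 1 + ?t"
    using zero_le_power2[of "norm x - 1"] by (simp add: power2_diff) (smt (verit) norm_ge_zero)
  have 2: "1 + k / 2 * ?t \<le> ?E"
    by (rule exp_ge_add_one_self)
  then have "?t \<le> 2 / k * ?E"
    using assms by (simp add: field_simps)
  moreover have "1 \<le> ?E"
    using assms by simp
  ultimately have "1 + norm x \<le> (2 + 2 / k) * ?E"
    using 1 unfolding distrib_right by linarith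
  then have "(1 + norm x) * gauss k x \<le> ((2 + 2 / k) * ?E) * gauss k x"
    by (intro mult_right_mono gauss_nonneg)
  also have "?E * gauss k x = gauss (k / 2) x"
    by (simp add: gauss_def exp_add[symmetric])
  then have "((2 + 2 / k) * ?E) * gauss k x = (2 + 2 / k) * gauss (k / 2) x"
    by simp
  finally show ?thesis .
qed

text \<open>Rests on |x|^2 \<le> 2 |y|^2 + 2 r^2. It serves to dominate a derivative at the
  intermediate point of the mean value theorem, whose position is unknown, by a function of x
  alone.\<close>

lemma gauss_near_le:
  assumes "c > 0" "norm (x - y) \<le> r"
  shows "gauss c y \<le> exp (c * r\<^sup>2) * gauss (c / 2) x"
proof -
  have "norm x \<le> norm y + r"
    using assms(2) norm_triangle_sub[of x y] by linarith
  then have "(norm x)\<^sup>2 \<le> (norm y + r)\<^sup>2"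
    by (intro power_mono) auto
  also have "\<dots> \<le> 2 * (norm y)\<^sup>2 + 2 * r\<^sup>2"
    using zero_le_power2[of "norm y - r"] by (simp add: power2_eq_square algebra_simps)
  finally have "c * (norm x)\<^sup>2 \<le> c * (2 * (norm y)\<^sup>2 + 2 * r\<^sup>2)"
    using assms(1) by (intro mult_left_mono) auto
  then show ?thesis
    by (simp add: gauss_def exp_add[symmetric] algebra_simps)
qed

text \<open>The rate is existentially quantified so that it may shrink from lemma to lemma: a factor
  of linear growth halves it, and no rate has to be tracked.\<close>

definition gdom :: "('a::euclidean_space \<Rightarrow> real) \<Rightarrow> bool" where
  "gdom f \<longleftrightarrow> (\<exists>M c. c > 0 \<and> M \<ge> 0 \<and> (\<forall>x. \<bar>f x\<bar> \<le> M * gauss c x))"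

definition lin_growth :: "('a::euclidean_space \<Rightarrow> real) \<Rightarrow> bool" where
  "lin_growth f \<longleftrightarrow> (\<exists>C\<ge>0. \<forall>x. \<bar>f x\<bar> \<le> C * (1 + norm x))"

lemma gdom_integrable:
  assumes "gdom f" and [measurable]: "f \<in> borel_measurable borel"
  shows "integrable lborel f"
proof -
  obtain M c where "c > 0" and M: "\<And>x. \<bar>f x\<bar> \<le> M * gauss c x"
    using assms unfolding gdom_def by blast
  then have "integrable lborel (\<lambda>x::'a. M * gauss c x)"
    by (intro integrable_mult_right integrable_gauss)
  then show ?thesis
    by (rule Bochner_Integration.integrable_bound)
       (auto intro!: AE_I2 order_trans[OF M])
qed

lemma gdom_gauss: "k > 0 \<Longrightarrow> gdom (gauss k)"
  unfolding gdom_def by (rule exI[of _ 1], rule exI[of _ k]) (auto simp: abs_of_pos[OF gauss_pos])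

lemma gdom_mono:
  assumes "gdom f" "\<And>x. \<bar>g x\<bar> \<le> C * \<bar>f x\<bar>"
  shows "gdom g"
proof -
  obtain M c where c: "c > 0" "M \<ge> 0" and M: "\<And>x. \<bar>f x\<bar> \<le> M * gauss c x"
    using assms unfolding gdom_def by blast
  have "\<bar>g x\<bar> \<le> (\<bar>C\<bar> * M) * gauss c x" for x
  proof -
    have "\<bar>g x\<bar> \<le> \<bar>C\<bar> * \<bar>f x\<bar>"
      using assms(2)[of x] by (smt (verit) mult_right_mono)
    also have "\<dots> \<le> \<bar>C\<bar> * (M * gauss c x)"
      by (intro mult_left_mono M) auto
    finally show ?thesis by simp
  qed
  then show ?thesis
    unfolding gdom_def using c by (intro exI[of _ "\<bar>C\<bar> * M"] exI[of _ c]) auto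
qed

lemma gdom_add:
  assumes "gdom f" "gdom g"
  shows "gdom (\<lambda>x. f x + g x)"
proof -
  obtain M c where c: "c > 0" "M \<ge> 0" and M: "\<And>x. \<bar>f x\<bar> \<le> M * gauss c x"
    using assms unfolding gdom_def by blast
  obtain N d where d: "d > 0" "N \<ge> 0" and N: "\<And>x. \<bar>g x\<bar> \<le> N * gauss d x"
    using assms unfolding gdom_def by blast
  have "\<bar>f x + g x\<bar> \<le> (M + N) * gauss (min c d) x" for x
  proof -
    have "gauss c x \<le> gauss (min c d) x" "gauss d x \<le> gauss (min c d) x"
      by (auto simp: gauss_def mult_right_mono)
    then have "M * gauss c x + N * gauss d x \<le> (M + N) * gauss (min c d) x"
      unfolding distrib_right using c d by (intro add_mono mult_left_mono) auto
    then show ?thesis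
      using M[of x] N[of x] by linarith
  qed
  then show ?thesis
    unfolding gdom_def using c d by (intro exI[of _ "M + N"] exI[of _ "min c d"]) auto
qed

lemma gdom_cmult: "gdom f \<Longrightarrow> gdom (\<lambda>x. c * f x)"
  by (rule gdom_mono[where C = "\<bar>c\<bar>"]) (auto simp: abs_mult)

lemma gdom_mult_lin_growth:
  assumes "gdom f" "lin_growth g"
  shows "gdom (\<lambda>x. g x * f x)"
proof -
  obtain M c where c: "c > 0" "M \<ge> 0" and M: "\<And>x. \<bar>f x\<bar> \<le> M * gauss c x"
    using assms unfolding gdom_def by blast
  obtain C where C: "C \<ge> 0" "\<And>x. \<bar>g x\<bar> \<le> C * (1 + norm x)"
    using assms unfolding lin_growth_def by blast
  have "\<bar>g x * f x\<bar> \<le> (C * M * (2 + 2 / c)) * gauss (c / 2) x" for x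
  proof -
    have "\<bar>g x * f x\<bar> \<le> (C * (1 + norm x)) * (M * gauss c x)"
      unfolding abs_mult using C M by (intro mult_mono) auto
    also have "\<dots> = (C * M) * ((1 + norm x) * gauss c x)"
      by simp
    also have "\<dots> \<le> (C * M) * ((2 + 2 / c) * gauss (c / 2) x)"
      using c C by (intro mult_left_mono norm_mult_gauss_le) auto
    finally show ?thesis by (simp add: mult.assoc)
  qed
  then show ?thesis
    unfolding gdom_def using c C by (intro exI[of _ "C * M * (2 + 2 / c)"] exI[of _ "c / 2"]) auto
qed

lemma lin_growth_bounded:
  assumes "\<And>x. \<bar>g x\<bar> \<le> C"
  shows "lin_growth g"
proof -
  have "\<bar>g x\<bar> \<le> \<bar>C\<bar> * (1 + norm x)" for x
  proof -
    have "\<bar>C\<bar> * 1 \<le> \<bar>C\<bar> * (1 + norm x)"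
      by (intro mult_left_mono) auto
    then show ?thesis
      using assms[of x] by linarith
  qed
  then show ?thesis
    unfolding lin_growth_def by (intro exI[of _ "\<bar>C\<bar>"]) auto
qed

lemma lin_growth_norm_le:
  assumes "\<And>x. \<bar>g x\<bar> \<le> C * norm x"
  shows "lin_growth g"
proof -
  have "\<bar>g x\<bar> \<le> \<bar>C\<bar> * (1 + norm x)" for x
  proof -
    have "C * norm x \<le> \<bar>C\<bar> * (1 + norm x)"
      by (intro mult_mono) auto
    then show ?thesis
      using assms[of x] by linarith
  qed
  then show ?thesis
    unfolding lin_growth_def by (intro exI[of _ "\<bar>C\<bar>"]) auto
qed

lemma lin_growth_inner: "lin_growth (\<lambda>x. x \<bullet> e)"
  by (rule lin_growth_norm_le[of _ "norm e"]) (metis Cauchy_Schwarz_ineq2 mult.commute)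

text \<open>On a ball of radius R the weight \<open>gauss 1\<close> is at least exp (- R^2), so a
  bounded function that vanishes outside the ball is dominated; boundedness comes from compactness
  of the ball.\<close>

lemma gdom_compact_support:
  fixes f :: "'a::euclidean_space \<Rightarrow> real"
  assumes "continuous_on UNIV f" "bounded {x. f x \<noteq> 0}"
  shows "gdom f" "\<exists>C. \<forall>x. \<bar>f x\<bar> \<le> C"
proof -
  obtain R where R: "\<And>x. f x \<noteq> 0 \<Longrightarrow> norm x \<le> R"
    using assms(2) unfolding bounded_iff by auto
  have "compact (f ` cball 0 R)"
    by (intro compact_continuous_image continuous_on_subset[OF assms(1)]) auto
  then obtain C where "\<And>y. y \<in> f ` cball 0 R \<Longrightarrow> norm y \<le> C"
    using compact_imp_bounded bounded_iff by metis
  then have C: "\<bar>f x\<bar> \<le> \<bar>C\<bar>" for x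
    using R[of x] by (cases "f x = 0") force+
  then show "\<exists>C. \<forall>x. \<bar>f x\<bar> \<le> C" by blast
  have "\<bar>f x\<bar> \<le> (\<bar>C\<bar> * exp (R\<^sup>2)) * gauss 1 x" for x
  proof (cases "f x = 0")
    case False
    have "norm x \<le> R"
      using R False by auto
    then have "(norm x)\<^sup>2 \<le> R\<^sup>2"
      by (intro power_mono) auto
    then have "1 \<le> exp (R\<^sup>2) * gauss 1 x"
      by (simp add: gauss_def exp_add[symmetric])
    then have "\<bar>C\<bar> * 1 \<le> \<bar>C\<bar> * (exp (R\<^sup>2) * gauss 1 x)"
      by (intro mult_left_mono) auto
    then show ?thesis
      using C[of x] by simp
  qed (simp add: gauss_nonneg)
  then show "gdom f"
    unfolding gdom_def by (intro exI[of _ "\<bar>C\<bar> * exp (R\<^sup>2)"] exI[of _ 1]) auto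
qed

section \<open>Integrals of directional derivatives\<close>

lemma integral_translate:
  fixes g :: "'a::euclidean_space \<Rightarrow> real"
  assumes "integrable lborel g"
  shows "integrable lborel (\<lambda>x. g (a + x))" "(\<integral>x. g (a + x) \<partial>lborel) = (\<integral>x. g x \<partial>lborel)"
proof -
  have g: "g \<in> borel_measurable borel"
    using assms by auto
  have "integrable (distr lborel borel ((+) a)) g" 
    using assms by (simp add: lborel_distr_plus)
  then show "integrable lborel (\<lambda>x. g (a + x))"
    by (subst (asm) integrable_distr_eq) (auto simp: g)
  have "(\<integral>x. g x \<partial>distr lborel borel ((+) a)) = (\<integral>x. g (a + x) \<partial>lborel)"
    by (subst integral_distr) (auto simp: g)
  then show "(\<integral>x. g (a + x) \<partial>lborel) = (\<integral>x. g x \<partial>lborel)"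
    by (simp add: lborel_distr_plus)
qed

text \<open>Difference quotients along \<open>e\<close> integrate to 0 by translation invariance.
  Each of them equals the derivative at a nearby point, so Gaussian domination survives at half the
  rate and dominated convergence applies.\<close>

lemma integral_dir_deriv_zero:
  fixes g :: "'a::euclidean_space \<Rightarrow> real"
  assumes der: "\<And>x. (g has_derivative D x) (at x)"
    and g: "integrable lborel g"
    and dom: "gdom (\<lambda>x. D x e)"
    and cont: "continuous_on UNIV (\<lambda>x. D x e)"
  shows "(\<integral>x. D x e \<partial>lborel) = 0"
proof -
  obtain M c where c: "c > 0" "M \<ge> 0" and M: "\<And>x. \<bar>D x e\<bar> \<le> M * gauss c x"
    using dom unfolding gdom_def by blast
  have [measurable]: "(\<lambda>x. D x e) \<in> borel_measurable borel" "g \<in> borel_measurable borel"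
    using cont g by (auto intro: borel_measurable_continuous_onI)
  \<comment> \<open>Steps of length at most 1 keep the intermediate point within distance
    \<open>norm e\<close> of x, which makes the bound uniform in n.\<close>
  define t where "t n = inverse (real (Suc n))" for n
  have t: "0 < t n" "t n \<le> 1" for n
    by (auto simp: t_def divide_simps)
  define s where "s n x = (g (t n *\<^sub>R e + x) - g x) / t n" for n x
  have line: "((\<lambda>r. g (x + r *\<^sub>R e)) has_real_derivative D (x + r *\<^sub>R e) e) (at r)" for x r
  proof -
    have "((\<lambda>r. g (x + r *\<^sub>R e)) has_derivative (\<lambda>h. D (x + r *\<^sub>R e) (h *\<^sub>R e))) (at r)"
      by (rule has_derivative_compose[OF _ der]) (auto intro!: derivative_eq_intros)
    moreover have "linear (D (x + r *\<^sub>R e))"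
      using der has_derivative_linear by blast
    ultimately show ?thesis
      by (simp add: has_field_derivative_def linear_cmul mult_commute_abs)
  qed
  have "(\<lambda>n. \<integral>x. s n x \<partial>lborel) \<longlonglongrightarrow> (\<integral>x. D x e \<partial>lborel)"
  proof (rule integral_dominated_convergence[where w = "\<lambda>x. M * exp (c * (norm e)\<^sup>2) * gauss (c / 2) x"])
    show "integrable lborel (\<lambda>x::'a. M * exp (c * (norm e)\<^sup>2) * gauss (c / 2) x)"
      using c by (intro integrable_mult_right integrable_gauss) auto
    show "s n \<in> borel_measurable lborel" for n
      unfolding s_def by measurable
    have "(\<lambda>n. s n x) \<longlonglongrightarrow> D x e" for x
    proof -
      have "((\<lambda>h. (g (x + (0 + h) *\<^sub>R e) - g (x + 0 *\<^sub>R e)) / h) \<longlongrightarrow> D x e) (at 0)"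
        using line[of x 0] unfolding has_field_derivative_iff by simp
      moreover have "filterlim t (at 0) sequentially"
        unfolding filterlim_at t_def
        using LIMSEQ_inverse_real_of_nat by auto
      ultimately have "(\<lambda>n. (g (x + (0 + t n) *\<^sub>R e) - g (x + 0 *\<^sub>R e)) / t n) \<longlonglongrightarrow> D x e"
        by (rule filterlim_compose)
      then show ?thesis
        by (simp add: s_def add.commute)
    qed
    then show "AE x in lborel. (\<lambda>n. s n x) \<longlonglongrightarrow> D x e" by simp
    have "\<bar>s n x\<bar> \<le> M * exp (c * (norm e)\<^sup>2) * gauss (c / 2) x" for n x
    proof -
      obtain z where z: "0 < z" "z < t n"
        "g (x + t n *\<^sub>R e) - g (x + 0 *\<^sub>R e) = (t n - 0) * D (x + z *\<^sub>R e) e"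
        using MVT2[OF t(1)[of n], of "\<lambda>r. g (x + r *\<^sub>R e)" "\<lambda>r. D (x + r *\<^sub>R e) e"] line by blast
      then have "s n x = D (x + z *\<^sub>R e) e"
        using t(1)[of n] by (simp add: s_def add.commute)
      moreover have "norm (x - (x + z *\<^sub>R e)) \<le> norm e"
        using z t(2)[of n] by (simp add: mult_left_le_one_le)
      then have "M * gauss c (x + z *\<^sub>R e) \<le> M * (exp (c * (norm e)\<^sup>2) * gauss (c / 2) x)"
        using c by (intro mult_left_mono gauss_near_le) auto
      ultimately show ?thesis
        using M[of "x + z *\<^sub>R e"] by (simp add: mult.assoc)
    qed
    then show "AE x in lborel. norm (s n x) \<le> M * exp (c * (norm e)\<^sup>2) * gauss (c / 2) x" for n
      by simp
  qed auto
  moreover have "(\<integral>x. s n x \<partial>lborel) = 0" for n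
    unfolding s_def using integral_translate[OF g] g by simp
  ultimately show ?thesis
    by (simp add: LIMSEQ_const_iff)
qed

section \<open>Functions of class C^n with bounded support\<close>

definition pd :: "'a \<Rightarrow> ('a::euclidean_space \<Rightarrow> real) \<Rightarrow> 'a \<Rightarrow> real" where
  "pd i f x = frechet_derivative f (at x) i"

text \<open>Finite-order regularity in place of the coinductive \<open>smooth_fun\<close>: only
  finitely many derivatives are taken, and closure under sums and products becomes induction on the
  order.\<close>

primrec Ck :: "nat \<Rightarrow> ('a::euclidean_space \<Rightarrow> real) \<Rightarrow> bool" where
  "Ck 0 f \<longleftrightarrow> continuous_on UNIV f"
| "Ck (Suc n) f \<longleftrightarrow> (\<forall>x. f differentiable (at x)) \<and> (\<forall>i\<in>Basis. Ck n (pd i f))"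

lemma pdI: "(f has_derivative D) (at x) \<Longrightarrow> pd i f x = D i"
  unfolding pd_def by (metis frechet_derivative_at)

lemma differentiable_pd:
  assumes "f differentiable (at x)"
  shows "(f has_derivative (\<lambda>h. \<Sum>i\<in>Basis. (h \<bullet> i) * pd i f x)) (at x)"
proof -
  have D: "(f has_derivative frechet_derivative f (at x)) (at x)"
    using assms by (simp add: frechet_derivative_works)
  have lin: "linear (frechet_derivative f (at x))"
    using D has_derivative_linear by blast
  have "frechet_derivative f (at x) h = (\<Sum>i\<in>Basis. (h \<bullet> i) * pd i f x)" for h
  proof -
    have "frechet_derivative f (at x) h = frechet_derivative f (at x) (\<Sum>i\<in>Basis. (h \<bullet> i) *\<^sub>R i)"
      by (simp add: euclidean_representation)
    then show ?thesis
      by (simp add: linear_sum[OF lin] linear_cmul[OF lin] pd_def)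
  qed
  then show ?thesis
    using D by (metis (no_types, lifting) ext)
qed

lemma Ck_continuous: "Ck n f \<Longrightarrow> continuous_on UNIV f"
proof (cases n)
  case (Suc m)
  assume "Ck n f"
  then have "\<And>x. f differentiable (at x)"
    using Suc by simp
  then show ?thesis
    by (simp add: continuous_at_imp_continuous_on differentiable_imp_continuous_within)
qed simp

lemma Ck_Suc_imp: "Ck (Suc n) f \<Longrightarrow> Ck n f"
proof (induction n arbitrary: f)
  case 0
  then show ?case using Ck_continuous[of "Suc 0" f] by simp
qed auto

lemma smooth_fun_Ck: "smooth_fun f \<Longrightarrow> Ck n f"
proof (induction n arbitrary: f)
  case 0
  then show ?case
    by (auto elim!: smooth_fun.cases
        intro!: continuous_at_imp_continuous_on differentiable_imp_continuous_within)
next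
  case (Suc n)
  then show ?case
    by (auto elim!: smooth_fun.cases simp: pd_def[abs_def])
qed

lemma Ck_const: "Ck n (\<lambda>x. c)"
proof (induction n arbitrary: c)
  case (Suc n)
  have "pd i (\<lambda>x. c) = (\<lambda>x. 0)" for i :: 'a
    by (rule ext, rule pdI) (rule has_derivative_const)
  then show ?case using Suc by simp
qed simp

lemma pd_inner: "pd i (\<lambda>x. x \<bullet> e) x = i \<bullet> e"
  by (rule pdI) (auto intro!: derivative_eq_intros)

lemma Ck_inner: "Ck n (\<lambda>x. x \<bullet> e)"
proof (cases n)
  case (Suc n)
  have "pd i (\<lambda>x. x \<bullet> e) = (\<lambda>x. i \<bullet> e)" for i :: 'a
    by (rule ext, rule pdI) (auto intro!: derivative_eq_intros)
  then show ?thesis using Suc by (auto simp: Ck_const intro!: differentiable_inner)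
qed (auto intro!: continuous_intros)

lemma pd_add:
  assumes "f differentiable (at x)" "g differentiable (at x)"
  shows "pd i (\<lambda>x. f x + g x) x = pd i f x + pd i g x"
  using pdI[OF has_derivative_add[OF assms[unfolded frechet_derivative_works]]]
  by (simp add: pd_def)

lemma pd_mult:
  assumes "f differentiable (at x)" "g differentiable (at x)"
  shows "pd i (\<lambda>x. f x * g x) x = f x * pd i g x + pd i f x * g x"
  using pdI[OF has_derivative_mult[OF assms[unfolded frechet_derivative_works]]]
  by (simp add: pd_def)

lemma pd_diff:
  assumes "f differentiable (at x)" "g differentiable (at x)"
  shows "pd i (\<lambda>x. f x - g x) x = pd i f x - pd i g x"
  using pdI[OF has_derivative_diff[OF assms[unfolded frechet_derivative_works]]]
  by (simp add: pd_def)

lemma Ck_add: "Ck n f \<Longrightarrow> Ck n g \<Longrightarrow> Ck n (\<lambda>x. f x + g x)"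
proof (induction n arbitrary: f g)
  case (Suc n)
  have "pd i (\<lambda>x. f x + g x) = (\<lambda>x. pd i f x + pd i g x)" for i
    using Suc.prems by (intro ext pd_add) auto
  with Suc show ?case by (auto intro!: differentiable_add)
qed (auto intro!: continuous_intros)

lemma Ck_mult: "Ck n f \<Longrightarrow> Ck n g \<Longrightarrow> Ck n (\<lambda>x. f x * g x)"
proof (induction n arbitrary: f g)
  case (Suc n)
  have "pd i (\<lambda>x. f x * g x) = (\<lambda>x. f x * pd i g x + pd i f x * g x)" for i
    using Suc.prems by (intro ext pd_mult) auto
  moreover have "Ck n (\<lambda>x. f x * pd i g x + pd i f x * g x)" if "i \<in> Basis" for i
    using Suc.prems that Ck_Suc_imp[OF Suc.prems(1)] Ck_Suc_imp[OF Suc.prems(2)]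
    by (intro Ck_add Suc.IH) auto
  ultimately show ?case
    using Suc.prems by (simp add: differentiable_mult)
qed (auto intro!: continuous_intros)

lemma has_derivative_gauss:
  "(gauss k has_derivative (\<lambda>h. - 2 * k * (x \<bullet> h) * gauss k x)) (at x)"
proof -
  have "((\<lambda>x::'a. - k * (x \<bullet> x)) has_derivative (\<lambda>h. - 2 * k * (x \<bullet> h))) (at x)"
    by (auto intro!: derivative_eq_intros simp: inner_commute[of _ x])
  from has_derivative_exp[OF this] show ?thesis
    by (simp add: gauss_def[abs_def] power2_norm_eq_inner mult_ac)
qed

lemma pd_gauss: "pd i (gauss k) x = - 2 * k * (x \<bullet> i) * gauss k x"
  by (rule pdI[OF has_derivative_gauss])

lemma Ck_gauss: "Ck n (gauss k)"
proof (induction n)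
  case (Suc n)
  have "pd i (gauss k) = (\<lambda>x. (- 2 * k) * ((x \<bullet> i) * gauss k x))" for i :: 'a
    by (auto simp: pd_gauss)
  moreover have "gauss k differentiable (at x)" for x :: 'a
    using has_derivative_gauss differentiable_def by blast
  ultimately show ?case
    using Suc Ck_mult[OF Ck_const Ck_mult[OF Ck_inner]] by (simp only: Ck.simps) blast
qed (simp add: continuous_gauss)

definition Ckc :: "nat \<Rightarrow> ('a::euclidean_space \<Rightarrow> real) \<Rightarrow> bool" where
  "Ckc n f \<longleftrightarrow> Ck n f \<and> bounded {x. f x \<noteq> 0}"

text \<open>Outside a ball that contains the support, f agrees with 0 on an open set.\<close>

lemma pd_bounded_support:
  assumes "bounded {x. f x \<noteq> 0}"
  shows "bounded {x. pd i f x \<noteq> 0}"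
proof -
  obtain R where R: "\<And>x. f x \<noteq> 0 \<Longrightarrow> norm x \<le> R"
    using assms unfolding bounded_iff by auto
  have "pd i f x = 0" if "x \<in> - cball 0 R" for x
  proof -
    have "((\<lambda>x. 0::real) has_derivative (\<lambda>x. 0)) (at x)" by simp
    then have "(f has_derivative (\<lambda>x. 0)) (at x)"
      by (rule has_derivative_transform_within_open[where s = "- cball 0 R"]) (use R that in force)+
    then show ?thesis by (rule pdI)
  qed
  then have "{x. pd i f x \<noteq> 0} \<subseteq> cball 0 R" by blast
  then show ?thesis using bounded_cball bounded_subset by blast
qed

lemma Ckc_pd: "Ckc (Suc n) f \<Longrightarrow> i \<in> Basis \<Longrightarrow> Ckc n (pd i f)"
  unfolding Ckc_def by (auto intro: pd_bounded_support)

lemma Ckc_Suc_imp: "Ckc (Suc n) f \<Longrightarrow> Ckc n f"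
  unfolding Ckc_def using Ck_Suc_imp by blast

lemma Ckc_mono:
  assumes "Ckc n f" "m \<le> n"
  shows "Ckc m f"
  using assms(2,1) by (induction n rule: dec_induct) (use Ckc_Suc_imp in blast)+

lemma Ckc_mult: "Ckc n f \<Longrightarrow> Ck n g \<Longrightarrow> Ckc n (\<lambda>x. f x * g x)"
  unfolding Ckc_def by (auto intro!: Ck_mult intro: bounded_subset[of "{x. f x \<noteq> 0}"])

lemma Ckc_diff: "Ckc n f \<Longrightarrow> Ckc n g \<Longrightarrow> Ckc n (\<lambda>x. f x - g x)"
proof -
  assume f: "Ckc n f" and g: "Ckc n g"
  have "bounded ({x. f x \<noteq> 0} \<union> {x. g x \<noteq> 0})"
    using f g by (simp add: Ckc_def)
  then have "bounded {x. f x - g x \<noteq> 0}"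
    by (rule bounded_subset) auto
  moreover have "Ck n (\<lambda>x. f x + (- 1) * g x)"
    using f g unfolding Ckc_def by (intro Ck_add Ck_mult Ck_const) auto
  ultimately show ?thesis
    by (simp add: Ckc_def)
qed

lemma Ckc_mult_left: "Ck n g \<Longrightarrow> Ckc n f \<Longrightarrow> Ckc n (\<lambda>x. g x * f x)"
  using Ckc_mult[of n f g] by (simp add: mult.commute)

lemma Ckc_imp_Ck: "Ckc n f \<Longrightarrow> Ck n f"
  by (simp add: Ckc_def)

lemma Ckc_continuous: "Ckc n f \<Longrightarrow> continuous_on UNIV f"
  unfolding Ckc_def using Ck_continuous by blast

lemma Ckc_measurable: "Ckc n f \<Longrightarrow> f \<in> borel_measurable borel"
  by (rule borel_measurable_continuous_onI) (rule Ckc_continuous)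

lemma Ckc_gdom: "Ckc n f \<Longrightarrow> gdom f"
  using gdom_compact_support Ckc_continuous unfolding Ckc_def by blast

lemma Ckc_bdd: "Ckc n f \<Longrightarrow> \<exists>C. \<forall>x. \<bar>f x\<bar> \<le> C"
  using gdom_compact_support Ckc_continuous unfolding Ckc_def by blast

lemma Ckc_integrable: "Ckc n f \<Longrightarrow> integrable lborel f"
  by (intro gdom_integrable Ckc_gdom Ckc_measurable)

lemma Ckc_has_derivative:
  "Ckc (Suc n) f \<Longrightarrow> (f has_derivative (\<lambda>h. \<Sum>i\<in>Basis. (h \<bullet> i) * pd i f x)) (at x)"
  by (intro differentiable_pd) (auto simp: Ckc_def)

section \<open>Gaussian integration by parts and correlated pairs\<close>

text \<open>By the mean value theorem \<open>H\<close> bounds all difference quotients, whatever the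
  step; passing to sequences makes dominated convergence available.\<close>

lemma DERIV_lebesgue_integral:
  fixes F :: "real \<Rightarrow> 'a \<Rightarrow> real"
  assumes der: "\<And>t w. ((\<lambda>t. F t w) has_real_derivative F' t w) (at t)"
    and F: "\<And>t. integrable M (F t)"
    and F': "\<And>t. F' t \<in> borel_measurable M"
    and H: "integrable M H" "\<And>t w. \<bar>F' t w\<bar> \<le> H w"
  shows "((\<lambda>t. \<integral>w. F t w \<partial>M) has_real_derivative (\<integral>w. F' t w \<partial>M)) (at t)"
proof -
  define q where "q h w = (F (t + h) w - F t w) / h" for h w
  have "((\<lambda>h. \<integral>w. q h w \<partial>M) \<longlongrightarrow> (\<integral>w. F' t w \<partial>M)) (at 0)"
    unfolding tendsto_at_iff_sequentially comp_def
  proof (intro allI impI)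
    fix X :: "nat \<Rightarrow> real"
    assume X0: "\<forall>i. X i \<in> UNIV - {0}" and X: "X \<longlonglongrightarrow> 0"
    show "(\<lambda>n. \<integral>w. q (X n) w \<partial>M) \<longlonglongrightarrow> (\<integral>w. F' t w \<partial>M)"
    proof (rule integral_dominated_convergence[where w = H])
      show "q (X n) \<in> borel_measurable M" for n
        unfolding q_def using F by (intro measurable) auto
      have "(\<lambda>n. q (X n) w) \<longlonglongrightarrow> F' t w" for w
      proof -
        have "((\<lambda>h. q h w) \<longlongrightarrow> F' t w) (at 0)"
          using der[of w t] unfolding DERIV_def q_def by simp
        then show ?thesis
          using X0 X unfolding tendsto_at_iff_sequentially comp_def by blast
      qed
      then show "AE w in M. (\<lambda>n. q (X n) w) \<longlonglongrightarrow> F' t w" by simp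
      have "\<bar>q h w\<bar> \<le> H w" if "h \<noteq> 0" for h w
      proof -
        have "\<exists>\<xi>. F (t + h) w - F t w = h * F' \<xi> w"
        proof (cases "h > 0")
          case True
          then show ?thesis
            using MVT2[of t "t + h" "\<lambda>t. F t w" "\<lambda>t. F' t w"] der by auto
        next
          case False
          then have "\<exists>z. F t w - F (t + h) w = (- h) * F' z w"
            using MVT2[of "t + h" t "\<lambda>t. F t w" "\<lambda>t. F' t w"] der that by auto
          then obtain z where "F t w - F (t + h) w = (- h) * F' z w" ..
          then show ?thesis by (intro exI[of _ z]) (simp add: algebra_simps)
        qed
        then obtain \<xi> where "F (t + h) w - F t w = h * F' \<xi> w" by blast
        then show ?thesis
          using H(2)[of \<xi> w] that by (simp add: q_def)
      qed
      then show "AE w in M. norm (q (X n) w) \<le> H w" for n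
        using X0 by simp
    qed (use F' H in auto)
  qed
  moreover have "(\<integral>w. q h w \<partial>M) = ((\<integral>w. F (t + h) w \<partial>M) - (\<integral>w. F t w \<partial>M)) / h" for h
    unfolding q_def using F by simp
  ultimately show ?thesis
    by (simp add: DERIV_def)
qed

text \<open>The derivative of \<open>h x * gauss k x\<close> along \<open>e\<close> integrates to 0,
  and differentiating the weight brings down the factor - 2 k (x \<bullet> e). Linear growth instead
  of boundedness admits h = x \<bullet> d, from which second moments follow.\<close>

lemma gauss_ibp:
  fixes h :: "'a::euclidean_space \<Rightarrow> real"
  assumes k: "k > 0"
    and der: "\<And>x. (h has_derivative D x) (at x)"
    and cont: "continuous_on UNIV (\<lambda>x. D x e)"
    and growth: "lin_growth h" "lin_growth (\<lambda>x. D x e)"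
  shows "(\<integral>x. D x e * gauss k x \<partial>lborel) = 2 * k * (\<integral>x. (x \<bullet> e) * (h x * gauss k x) \<partial>lborel)"
proof -
  have hc: "continuous_on UNIV h"
    using der has_derivative_continuous continuous_at_imp_continuous_on by blast
  have [measurable]: "h \<in> borel_measurable borel" "(\<lambda>x. D x e) \<in> borel_measurable borel"
    using hc cont by (auto intro: borel_measurable_continuous_onI)
  have dom: "gdom (\<lambda>x. h x * gauss k x)" "gdom (\<lambda>x. D x e * gauss k x)"
    using growth k by (auto intro!: gdom_mult_lin_growth gdom_gauss)
  have dom': "gdom (\<lambda>x. (x \<bullet> e) * (h x * gauss k x))"
    by (rule gdom_mult_lin_growth[OF dom(1) lin_growth_inner])
  have "0 = (\<integral>x. h x * (- 2 * k * (x \<bullet> e) * gauss k x) + D x e * gauss k x \<partial>lborel)"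
  proof (rule integral_dir_deriv_zero[symmetric])
    show "((\<lambda>x. h x * gauss k x) has_derivative
        (\<lambda>e. h x * (- 2 * k * (x \<bullet> e) * gauss k x) + D x e * gauss k x)) (at x)" for x
      by (rule has_derivative_mult[OF der has_derivative_gauss])
    show "integrable lborel (\<lambda>x. h x * gauss k x)"
      using dom by (intro gdom_integrable) auto
    have "gdom (\<lambda>x. (- 2 * k) * ((x \<bullet> e) * (h x * gauss k x)) + D x e * gauss k x)"
      by (intro gdom_add gdom_cmult dom dom')
    then show "gdom (\<lambda>x. h x * (- 2 * k * (x \<bullet> e) * gauss k x) + D x e * gauss k x)"
      by (simp add: mult_ac)
    show "continuous_on UNIV (\<lambda>x. h x * (- 2 * k * (x \<bullet> e) * gauss k x) + D x e * gauss k x)"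
      by (intro continuous_intros hc cont continuous_gauss)
  qed
  also have "\<dots> = (\<integral>x. (- 2 * k) * ((x \<bullet> e) * (h x * gauss k x)) + D x e * gauss k x \<partial>lborel)"
    by (simp add: mult_ac)
  also have "\<dots> = (- 2 * k) * (\<integral>x. (x \<bullet> e) * (h x * gauss k x) \<partial>lborel) + (\<integral>x. D x e * gauss k x \<partial>lborel)"
    using gdom_integrable[OF dom'] gdom_integrable[OF dom(2)] by simp
  finally show ?thesis by simp
qed

text \<open>Up to normalisation, the expectation of p(X) q(Y) for the jointly Gaussian X = L w and Y
  = K w. The covariance sits in the linear maps and not in a density, so the degenerate case X = Y
  is covered as well.\<close>

definition gpair ::
    "real \<Rightarrow> ('w::euclidean_space \<Rightarrow> 'a::euclidean_space) \<Rightarrow> ('w \<Rightarrow> 'a) \<Rightarrow>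
      ('a \<Rightarrow> real) \<Rightarrow> ('a \<Rightarrow> real) \<Rightarrow> real" where
  "gpair k L K p q = (\<integral>w. p (L w) * q (K w) * gauss k w \<partial>lborel)"

context
  fixes k :: real and L K :: "'w::euclidean_space \<Rightarrow> 'a::euclidean_space"
  assumes k: "k > 0" and L: "bounded_linear L" and K: "bounded_linear K"
begin

lemma continuous_comp_pair:
  assumes "Ckc m p" "Ckc n q"
  shows "continuous_on UNIV (\<lambda>w. p (L w))" "continuous_on UNIV (\<lambda>w. q (K w))"
  using continuous_on_compose2[OF Ckc_continuous[OF assms(1)] linear_continuous_on[OF L]]
    continuous_on_compose2[OF Ckc_continuous[OF assms(2)] linear_continuous_on[OF K]] by auto

lemma measurable_comp_pair:
  assumes "Ckc m p" "Ckc n q"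
  shows "(\<lambda>w. p (L w) * q (K w) * gauss k w) \<in> borel_measurable borel"
  by (intro borel_measurable_continuous_onI continuous_on_mult continuous_comp_pair[OF assms] continuous_gauss)

lemma gdom_comp_pair:
  assumes "Ckc m p" "Ckc n q"
  shows "gdom (\<lambda>w. p (L w) * q (K w) * gauss k w)"
proof -
  obtain P Q where PQ: "\<And>x. \<bar>p x\<bar> \<le> P" "\<And>x. \<bar>q x\<bar> \<le> Q"
    using assms Ckc_bdd by metis
  have "\<bar>p (L w) * q (K w)\<bar> \<le> P * Q" for w
    unfolding abs_mult by (intro mult_mono PQ order_trans[OF _ PQ(1)]) auto
  then show ?thesis
    using k by (intro gdom_mult_lin_growth gdom_gauss lin_growth_bounded) auto
qed

lemma integrable_comp_pair:
  assumes "Ckc m p" "Ckc n q"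
  shows "integrable lborel (\<lambda>w. p (L w) * q (K w) * gauss k w)"
  by (intro gdom_integrable gdom_comp_pair[OF assms]) (simp add: measurable_comp_pair[OF assms])

lemma integrable_inner_comp_pair:
  assumes "Ckc m p" "Ckc n q"
  shows "integrable lborel (\<lambda>w. (w \<bullet> e) * (p (L w) * q (K w) * gauss k w))"
  by (intro gdom_integrable gdom_mult_lin_growth lin_growth_inner gdom_comp_pair[OF assms])
     (intro borel_measurable_times measurable_comp_pair[OF assms], measurable)

text \<open>Gaussian integration by parts for the product p(L w) q(K w): a derivative along e
  reaches p through L e and q through K e.\<close>

lemma gpair_ibp:
  assumes p: "Ckc (Suc m) p" and q: "Ckc (Suc n) q"
  shows "2 * k * (\<integral>w. (w \<bullet> e) * (p (L w) * q (K w) * gauss k w) \<partial>lborel)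
    = (\<Sum>i\<in>Basis. (L e \<bullet> i) * gpair k L K (pd i p) q) + (\<Sum>i\<in>Basis. (K e \<bullet> i) * gpair k L K p (pd i q))"
proof -
  define D where "D w e = p (L w) * (\<Sum>i\<in>Basis. (K e \<bullet> i) * pd i q (K w))
      + (\<Sum>i\<in>Basis. (L e \<bullet> i) * pd i p (L w)) * q (K w)" for w e
  have p1: "Ckc m (pd i p)" and q1: "Ckc n (pd i q)" if "i \<in> Basis" for i
    using that p q Ckc_pd by auto
  have der: "((\<lambda>w. p (L w) * q (K w)) has_derivative D w) (at w)" for w
    unfolding D_def
    by (intro has_derivative_mult has_derivative_compose[OF _ Ckc_has_derivative[OF p]]
        has_derivative_compose[OF _ Ckc_has_derivative[OF q]]
        bounded_linear_imp_has_derivative L K)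
  have cont: "continuous_on UNIV (\<lambda>w. D w e)"
    unfolding D_def using continuous_comp_pair[OF p q] continuous_comp_pair[OF p1 q1]
    by (intro continuous_intros) auto
  obtain P Q where PQ: "\<And>x. \<bar>p x\<bar> \<le> P" "\<And>x. \<bar>q x\<bar> \<le> Q"
    using p q Ckc_bdd by metis
  have "\<exists>C. \<forall>i\<in>Basis. \<forall>x. \<bar>pd i p x\<bar> \<le> C i" "\<exists>C. \<forall>i\<in>Basis. \<forall>x. \<bar>pd i q x\<bar> \<le> C i"
    by (intro bchoice ballI Ckc_bdd[OF p1] Ckc_bdd[OF q1]; assumption)+
  then obtain P' Q' where PQ': "\<And>i x. i \<in> Basis \<Longrightarrow> \<bar>pd i p x\<bar> \<le> P' i" "\<And>i x. i \<in> Basis \<Longrightarrow> \<bar>pd i q x\<bar> \<le> Q' i"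
    by blast
  have b1: "\<bar>p (L w) * q (K w)\<bar> \<le> P * Q" for w
    unfolding abs_mult by (intro mult_mono PQ order_trans[OF _ PQ(1)]) auto
  have b2: "\<bar>D w e\<bar> \<le> P * (\<Sum>i\<in>Basis. \<bar>K e \<bullet> i\<bar> * Q' i) + (\<Sum>i\<in>Basis. \<bar>L e \<bullet> i\<bar> * P' i) * Q" for w
  proof -
    have "\<bar>\<Sum>i\<in>Basis. (K e \<bullet> i) * pd i q (K w)\<bar> \<le> (\<Sum>i\<in>Basis. \<bar>K e \<bullet> i\<bar> * Q' i)"
      by (intro order_trans[OF sum_abs] sum_mono) (auto simp: abs_mult intro!: mult_left_mono PQ')
    then have 1: "\<bar>p (L w) * (\<Sum>i\<in>Basis. (K e \<bullet> i) * pd i q (K w))\<bar> \<le> P * (\<Sum>i\<in>Basis. \<bar>K e \<bullet> i\<bar> * Q' i)"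
      unfolding abs_mult by (intro mult_mono PQ order_trans[OF _ PQ(1)[of 0]]) auto
    have s: "\<bar>\<Sum>i\<in>Basis. (L e \<bullet> i) * pd i p (L w)\<bar> \<le> (\<Sum>i\<in>Basis. \<bar>L e \<bullet> i\<bar> * P' i)"
      by (intro order_trans[OF sum_abs] sum_mono) (auto simp: abs_mult intro!: mult_left_mono PQ')
    then have 2: "\<bar>(\<Sum>i\<in>Basis. (L e \<bullet> i) * pd i p (L w)) * q (K w)\<bar> \<le> (\<Sum>i\<in>Basis. \<bar>L e \<bullet> i\<bar> * P' i) * Q"
      unfolding abs_mult by (intro mult_mono PQ order_trans[OF _ s]) auto
    show ?thesis
      unfolding D_def using 1 2 by linarith
  qed
  have "(\<integral>w. D w e * gauss k w \<partial>lborel) = 2 * k * (\<integral>w. (w \<bullet> e) * (p (L w) * q (K w) * gauss k w) \<partial>lborel)"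
    by (rule gauss_ibp[OF k der cont lin_growth_bounded[OF b1] lin_growth_bounded[OF b2]])
  moreover have "D w e * gauss k w = (\<Sum>i\<in>Basis. (L e \<bullet> i) * (pd i p (L w) * q (K w) * gauss k w))
      + (\<Sum>i\<in>Basis. (K e \<bullet> i) * (p (L w) * pd i q (K w) * gauss k w))" for w
    by (simp add: D_def sum_distrib_left sum_distrib_right distrib_right distrib_left mult_ac)
  ultimately show ?thesis
    using integrable_comp_pair[OF p1 q] integrable_comp_pair[OF p q1]
    by (simp add: gpair_def Bochner_Integration.integral_add Bochner_Integration.integral_sum)
qed

end

text \<open>If \<open>w\<close> has three independent Gaussian components, then \<open>rotL t w\<close> and \<open>rotR t w\<close> have correlation
  \<open>sin\<^sup>2 t\<close>; the angle keeps the interpolation smooth up to both endpoints, and the shared first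
  component makes nonnegativity evident.\<close>

definition rotL :: "real \<Rightarrow> 'a::euclidean_space \<times> 'a \<times> 'a \<Rightarrow> 'a" where
  "rotL t w = sin t *\<^sub>R fst w + cos t *\<^sub>R fst (snd w)"

definition rotR :: "real \<Rightarrow> 'a::euclidean_space \<times> 'a \<times> 'a \<Rightarrow> 'a" where
  "rotR t w = sin t *\<^sub>R fst w + cos t *\<^sub>R snd (snd w)"

lemma bounded_linear_rot: "bounded_linear (rotL t)" "bounded_linear (rotR t)"
  by (auto simp: linear_conv_bounded_linear[symmetric] linear_iff rotL_def rotR_def algebra_simps)

text \<open>The Mehler (Ornstein-Uhlenbeck) form at correlation sin^2 t, unnormalised: the three
  components of w contribute the cube of the mass of \<open>gauss k\<close>.\<close>

definition mehler :: "real \<Rightarrow> ('a::euclidean_space \<Rightarrow> real) \<Rightarrow> ('a \<Rightarrow> real) \<Rightarrow> real \<Rightarrow> real" where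
  "mehler k p q t = gpair k (rotL t) (rotR t) p q"

lemma DERIV_comp_line:
  assumes p: "Ckc (Suc n) p"
  shows "((\<lambda>t. p (sin t *\<^sub>R a + cos t *\<^sub>R b)) has_real_derivative
     (\<Sum>i\<in>Basis. (cos t * (a \<bullet> i) - sin t * (b \<bullet> i)) * pd i p (sin t *\<^sub>R a + cos t *\<^sub>R b))) (at t)"
proof -
  have "((\<lambda>t. p (sin t *\<^sub>R a + cos t *\<^sub>R b)) has_derivative
    (\<lambda>h. \<Sum>i\<in>Basis. (((h * cos t) *\<^sub>R a + (h * - sin t) *\<^sub>R b) \<bullet> i) * pd i p (sin t *\<^sub>R a + cos t *\<^sub>R b))) (at t)"
    by (rule has_derivative_compose[OF _ Ckc_has_derivative[OF p]])
       (auto intro!: derivative_eq_intros)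
  moreover have "(\<Sum>i\<in>Basis. (((h * cos t) *\<^sub>R a + (h * - sin t) *\<^sub>R b) \<bullet> i) * c i)
      = (\<Sum>i\<in>Basis. (cos t * (a \<bullet> i) - sin t * (b \<bullet> i)) * c i) * h" for h and c :: "'a \<Rightarrow> real"
    unfolding sum_distrib_right by (intro sum.cong refl) (simp add: algebra_simps inner_add_left)
  ultimately show ?thesis
    unfolding has_field_derivative_def by (simp add: mult_commute_abs)
qed

text \<open>In coordinate directions the sums of \<open>gpair_ibp\<close> collapse to single
  terms.\<close>

lemma sum_inner_Basis_scaleR:
  assumes "i \<in> Basis"
  shows "(\<Sum>j\<in>Basis. ((c *\<^sub>R i) \<bullet> j) * X j) = c * X i"
proof -
  have "(\<Sum>j\<in>Basis. ((c *\<^sub>R i) \<bullet> j) * X j) = (\<Sum>j\<in>Basis. if j = i then c * X j else 0)"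
    using assms by (intro sum.cong refl) (auto simp: inner_Basis)
  also have "\<dots> = c * X i"
    using assms by simp
  finally show ?thesis .
qed

text \<open>Differentiation in t produces coordinates of w as factors, which
  \<open>gpair_ibp\<close> trades for derivatives. The shared component yields sin t cos t times a
  second derivative of p, and the component belonging to p alone cancels exactly that; likewise for
  q. The mixed first derivatives survive with the factor 2 sin t cos t / (2 k). The two orders of
  differentiability are there for the terms that cancel.\<close>

lemma DERIV_mehler:
  fixes p q :: "'a::euclidean_space \<Rightarrow> real"
  assumes k: "k > 0" and p: "Ckc (Suc (Suc m)) p" and q: "Ckc (Suc (Suc n)) q"
  shows "(mehler k p q has_real_derivative
    sin (2 * t) / (2 * k) * (\<Sum>i\<in>Basis. mehler k (pd i p) (pd i q) t)) (at t)"
proof -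
  have p1: "Ckc (Suc m) (pd i p)" and q1: "Ckc (Suc n) (pd i q)" if "i \<in> Basis" for i
    using that p q Ckc_pd by auto
  have p0: "Ckc (Suc m) p" and q0: "Ckc (Suc n) q"
    using p q by (auto intro: Ckc_Suc_imp)
  define F where "F t w = p (rotL t w) * q (rotR t w) * gauss k w" for t w
  define A where "A i t w = pd i p (rotL t w) * q (rotR t w) * gauss k w" for i t w
  define B where "B i t w = p (rotL t w) * pd i q (rotR t w) * gauss k w" for i t w
  define F' where "F' t w =
      (\<Sum>i\<in>Basis. cos t * ((w \<bullet> (i, 0, 0)) * A i t w) - sin t * ((w \<bullet> (0, i, 0)) * A i t w))
    + (\<Sum>i\<in>Basis. cos t * ((w \<bullet> (i, 0, 0)) * B i t w) - sin t * ((w \<bullet> (0, 0, i)) * B i t w))" for t w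
  have L: "bounded_linear (rotL t :: 'a \<times> 'a \<times> 'a \<Rightarrow> 'a)" and R: "bounded_linear (rotR t :: 'a \<times> 'a \<times> 'a \<Rightarrow> 'a)" for t
    by (rule bounded_linear_rot)+
  obtain P Q where PQ: "\<And>x. \<bar>p x\<bar> \<le> P" "\<And>x. \<bar>q x\<bar> \<le> Q"
    using p q Ckc_bdd by metis
  have "\<exists>C. \<forall>i\<in>Basis. \<forall>x. \<bar>pd i p x\<bar> \<le> C i" "\<exists>C. \<forall>i\<in>Basis. \<forall>x. \<bar>pd i q x\<bar> \<le> C i"
    by (intro bchoice ballI Ckc_bdd[OF p1] Ckc_bdd[OF q1]; assumption)+
  then obtain P' Q' where PQ': "\<And>i x. i \<in> Basis \<Longrightarrow> \<bar>pd i p x\<bar> \<le> P' i" "\<And>i x. i \<in> Basis \<Longrightarrow> \<bar>pd i q x\<bar> \<le> Q' i"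
    by blast
  have "((\<lambda>t. F t w) has_real_derivative F' t w) (at t)" for t w
    unfolding F_def rotL_def rotR_def
    by (rule DERIV_cong, rule DERIV_cmult_right, rule DERIV_mult, rule DERIV_comp_line[OF p],
        rule DERIV_comp_line[OF q])
       (simp add: F'_def A_def B_def rotL_def rotR_def inner_prod_def sum_distrib_left
          sum_distrib_right algebra_simps)
  moreover have "integrable lborel (F t)" for t
    unfolding F_def by (rule integrable_comp_pair[OF k L R p q])
  moreover have i: "integrable lborel (\<lambda>w. (w \<bullet> e) * A i t w)" "integrable lborel (\<lambda>w. (w \<bullet> e) * B i t w)"
    if "i \<in> Basis" for i t e
    unfolding A_def B_def
    using integrable_inner_comp_pair[OF k L R p1[OF that] q] integrable_inner_comp_pair[OF k L R p q1[OF that]]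
    by auto
  moreover have "F' t \<in> borel_measurable lborel" for t
    unfolding F'_def
    by (intro borel_measurable_integrable Bochner_Integration.integrable_add
        Bochner_Integration.integrable_sum Bochner_Integration.integrable_diff integrable_mult_right i)
  \<comment> \<open>Each coordinate of w is at most \<open>norm w\<close>, sine and cosine are at
    most 1, and p, q and their partial derivatives are bounded; the factor 2 counts the cosine and
    the sine term.\<close>
  moreover define H where "H w = (\<Sum>i\<in>Basis. 2 * (P' i * Q + P * Q' i) * (norm w * gauss k w))" for w :: "'a \<times> 'a \<times> 'a"
  moreover have "integrable lborel H"
    unfolding H_def
    by (intro Bochner_Integration.integrable_sum integrable_mult_right gdom_integrable
        gdom_mult_lin_growth gdom_gauss lin_growth_norm_le[of _ 1] k) (simp, measurable)
  moreover have "\<bar>F' t w\<bar> \<le> H w" for t w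
  proof -
    have n: "\<bar>w \<bullet> (i, 0, 0)\<bar> \<le> norm w" "\<bar>w \<bullet> (0, i, 0)\<bar> \<le> norm w" "\<bar>w \<bullet> (0, 0, i)\<bar> \<le> norm w"
      if "i \<in> Basis" for i
      using that by (intro Basis_le_norm; force simp: Basis_prod_def zero_prod_def)+
    have cs: "\<bar>cos t * (u * c) - sin t * (v * c)\<bar> \<le> 2 * (C * (N * g))"
      if "\<bar>u\<bar> \<le> N" "\<bar>v\<bar> \<le> N" "\<bar>c\<bar> \<le> C * g" for u v c C N g
    proof -
      have "\<bar>cos t * (u * c)\<bar> \<le> 1 * (N * (C * g))" "\<bar>sin t * (v * c)\<bar> \<le> 1 * (N * (C * g))"
        unfolding abs_mult using that by (intro mult_mono; force)+
      then show ?thesis by (simp add: mult_ac)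
    qed
    have AB: "\<bar>A i t w\<bar> \<le> (P' i * Q) * gauss k w" "\<bar>B i t w\<bar> \<le> (P * Q' i) * gauss k w"
      if "i \<in> Basis" for i
    proof -
      have "P \<ge> 0" "Q \<ge> 0" "P' i \<ge> 0" "Q' i \<ge> 0"
        using PQ[of 0] PQ'[OF that, of 0] by linarith+
      then show "\<bar>A i t w\<bar> \<le> (P' i * Q) * gauss k w" "\<bar>B i t w\<bar> \<le> (P * Q' i) * gauss k w"
        unfolding A_def B_def abs_mult
        by (intro mult_mono PQ PQ'[OF that]; simp add: gauss_nonneg)+
    qed
    have "\<bar>F' t w\<bar> \<le> (\<Sum>i\<in>Basis. 2 * ((P' i * Q) * (norm w * gauss k w)))
        + (\<Sum>i\<in>Basis. 2 * ((P * Q' i) * (norm w * gauss k w)))"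
      unfolding F'_def
      by (intro order_trans[OF abs_triangle_ineq] add_mono order_trans[OF sum_abs] sum_mono cs n AB)
    also have "\<dots> = H w"
      by (simp add: H_def sum.distrib[symmetric] algebra_simps)
    finally show ?thesis .
  qed
  ultimately have "((\<lambda>t. \<integral>w. F t w \<partial>lborel) has_real_derivative (\<integral>w. F' t w \<partial>lborel)) (at t)"
    by (intro DERIV_lebesgue_integral[where H = H])
  moreover have "(\<integral>w. F' t w \<partial>lborel) = sin (2 * t) / (2 * k) * (\<Sum>i\<in>Basis. mehler k (pd i p) (pd i q) t)"
  proof -
    let ?g = "gpair k (rotL t) (rotR t)"
    have rot: "rotL t (i, 0, 0) = sin t *\<^sub>R i" "rotR t (i, 0, 0) = sin t *\<^sub>R i"
      "rotL t (0, i, 0) = cos t *\<^sub>R i" "rotR t (0, i, 0) = 0 *\<^sub>R i"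
      "rotL t (0, 0, i) = 0 *\<^sub>R i" "rotR t (0, 0, i) = cos t *\<^sub>R i" for i :: 'a
      by (auto simp: rotL_def rotR_def)
    \<comment> \<open>Direction (i, 0, 0) moves both arguments and gives two terms; (0, i, 0) moves
      only the argument of p, and (0, 0, i) only that of q.\<close>
    have ibpA: "(\<integral>w. (w \<bullet> (i, 0, 0)) * A i t w \<partial>lborel) = (sin t * ?g (pd i (pd i p)) q + sin t * ?g (pd i p) (pd i q)) / (2 * k)"
      "(\<integral>w. (w \<bullet> (0, i, 0)) * A i t w \<partial>lborel) = cos t * ?g (pd i (pd i p)) q / (2 * k)"
      and ibpB: "(\<integral>w. (w \<bullet> (i, 0, 0)) * B i t w \<partial>lborel) = (sin t * ?g (pd i p) (pd i q) + sin t * ?g p (pd i (pd i q))) / (2 * k)"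
      "(\<integral>w. (w \<bullet> (0, 0, i)) * B i t w \<partial>lborel) = cos t * ?g p (pd i (pd i q)) / (2 * k)"
      if i: "i \<in> Basis" for i
      using gpair_ibp[OF k L[of t] R[of t] p1[OF i] q0, where e = "(i, 0, 0)"]
        gpair_ibp[OF k L[of t] R[of t] p1[OF i] q0, where e = "(0, i, 0)"]
        gpair_ibp[OF k L[of t] R[of t] p0 q1[OF i], where e = "(i, 0, 0)"]
        gpair_ibp[OF k L[of t] R[of t] p0 q1[OF i], where e = "(0, 0, i)"]
        k
      unfolding A_def B_def rot sum_inner_Basis_scaleR[OF i] by (simp_all add: field_simps)
    have "(\<integral>w. F' t w \<partial>lborel) =
        (\<Sum>i\<in>Basis. cos t * (\<integral>w. (w \<bullet> (i, 0, 0)) * A i t w \<partial>lborel) - sin t * (\<integral>w. (w \<bullet> (0, i, 0)) * A i t w \<partial>lborel))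
      + (\<Sum>i\<in>Basis. cos t * (\<integral>w. (w \<bullet> (i, 0, 0)) * B i t w \<partial>lborel) - sin t * (\<integral>w. (w \<bullet> (0, 0, i)) * B i t w \<partial>lborel))"
      unfolding F'_def using i by simp
    also have "\<dots> = (\<Sum>i\<in>Basis. sin (2 * t) / (2 * k) * ?g (pd i p) (pd i q))"
      unfolding sum.distrib[symmetric]
      by (intro sum.cong refl) (simp only: ibpA ibpB sin_double, use k in \<open>simp add: field_simps\<close>)
    finally show ?thesis
      by (simp add: mehler_def sum_distrib_left)
  qed
  ultimately show ?thesis
    by (simp add: F_def gpair_def mehler_def[abs_def])
qed


section \<open>Sign and endpoint values of the Mehler form by Fubini\<close>

lemma integral_lborel_Pair:
  fixes f :: "'a::euclidean_space \<times> 'b::euclidean_space \<Rightarrow> real"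
  assumes "integrable lborel f"
  shows "(\<integral>w. f w \<partial>lborel) = (\<integral>x. (\<integral>y. f (x, y) \<partial>lborel) \<partial>lborel)"
  using lborel_pair.integral_fst'[of f] assms by (simp add: lborel_prod)

lemma integral_lborel_Pair_mult:
  fixes f :: "'a::euclidean_space \<Rightarrow> real" and g :: "'b::euclidean_space \<Rightarrow> real"
  assumes f: "integrable lborel f" and g: "integrable lborel g"
  shows "(\<integral>w. f (fst w) * g (snd w) \<partial>lborel) = (\<integral>x. f x \<partial>lborel) * (\<integral>y. g y \<partial>lborel)"
proof -
  have [measurable]: "f \<in> borel_measurable borel" "g \<in> borel_measurable borel"
    using f g by auto
  have "integrable (lborel \<Otimes>\<^sub>M lborel) (\<lambda>w. f (fst w) * g (snd w))"
    by (rule lborel_pair.Fubini_integrable)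
       (use f g in \<open>auto simp: abs_mult intro!: integrable_mult_left\<close>)
  then show ?thesis
    by (subst integral_lborel_Pair) (simp_all add: lborel_prod)
qed

lemma mehler_unfold:
  assumes "k > 0" "Ckc m p" "Ckc n q"
  shows "mehler k p q t = (\<integral>z. (\<integral>w. p (sin t *\<^sub>R z + cos t *\<^sub>R fst w) * q (sin t *\<^sub>R z + cos t *\<^sub>R snd w)
    * gauss k w \<partial>lborel) * gauss k z \<partial>lborel)"
proof -
  have "mehler k p q t = (\<integral>z. (\<integral>w. p (sin t *\<^sub>R z + cos t *\<^sub>R fst w) * q (sin t *\<^sub>R z + cos t *\<^sub>R snd w)
    * gauss k (z, w) \<partial>lborel) \<partial>lborel)"
    unfolding mehler_def gpair_def
    by (subst integral_lborel_Pair)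
       (use integrable_comp_pair[OF assms(1) bounded_linear_rot assms(2,3)] in \<open>auto simp: rotL_def rotR_def\<close>)
  then show ?thesis
    by (simp add: gauss_Pair mult_ac)
qed

text \<open>For a fixed value z of the shared component the two factors are independent copies of
  one function of a Gaussian vector, so the inner integral is a square.\<close>

lemma mehler_nonneg:
  assumes k: "k > 0" and p: "Ckc n p"
  shows "0 \<le> mehler k p p t"
proof -
  have inner: "(\<integral>w. p (sin t *\<^sub>R z + cos t *\<^sub>R fst w) * p (sin t *\<^sub>R z + cos t *\<^sub>R snd w) * gauss k w \<partial>lborel) \<ge> 0" for z
  proof -
    define f where "f y = p (sin t *\<^sub>R z + cos t *\<^sub>R y) * gauss k y" for y
    obtain P where P: "\<And>x. \<bar>p x\<bar> \<le> P"
      using p Ckc_bdd by metis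
    have "continuous_on UNIV (\<lambda>y. p (sin t *\<^sub>R z + cos t *\<^sub>R y))"
      by (rule continuous_on_compose2[OF Ckc_continuous[OF p]]) (auto intro!: continuous_intros)
    then have [measurable]: "(\<lambda>y. p (sin t *\<^sub>R z + cos t *\<^sub>R y)) \<in> borel_measurable borel"
      by (rule borel_measurable_continuous_onI)
    have "integrable lborel f"
      unfolding f_def
      by (intro gdom_integrable gdom_mult_lin_growth gdom_gauss k lin_growth_bounded[of _ P] P) measurable
    then have "(\<integral>w. f (fst w) * f (snd w) \<partial>lborel) = (\<integral>y. f y \<partial>lborel)\<^sup>2"
      by (subst integral_lborel_Pair_mult) (auto simp: power2_eq_square)
    moreover have "f (fst w) * f (snd w)
        = p (sin t *\<^sub>R z + cos t *\<^sub>R fst w) * p (sin t *\<^sub>R z + cos t *\<^sub>R snd w) * gauss k w" for w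
      by (cases w) (simp add: f_def gauss_Pair mult_ac)
    ultimately show ?thesis by simp
  qed
  show ?thesis
    unfolding mehler_unfold[OF k p p]
    by (rule integral_nonneg_AE, rule AE_I2, rule mult_nonneg_nonneg[OF inner gauss_nonneg])
qed

lemma integrable_Ckc_gauss:
  assumes "Ckc n p"
  shows "integrable lborel (\<lambda>x. p x * gauss k x)"
  using Ckc_integrable[OF Ckc_mult[OF assms Ck_gauss]] .

lemma integral_gauss_Pair:
  fixes k :: real
  assumes "k > 0"
  shows "(\<integral>w. gauss k w \<partial>(lborel :: ('a::euclidean_space \<times> 'a) measure)) = (\<integral>x. gauss k x \<partial>(lborel :: 'a measure))\<^sup>2"
proof -
  have "(\<integral>w. gauss k (fst w) * gauss k (snd w) \<partial>(lborel :: ('a \<times> 'a) measure)) = (\<integral>x. gauss k x \<partial>(lborel :: 'a measure))\<^sup>2"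
    using integrable_gauss[OF assms]
    by (subst integral_lborel_Pair_mult) (auto simp: power2_eq_square)
  then show ?thesis
    by (simp add: gauss_Pair[symmetric])
qed

text \<open>At t = 0 the arguments are independent and the shared component only contributes its
  mass Z; at t = pi / 2 both arguments equal the shared component and the other two contribute
  Z^2.\<close>

lemma mehler_endpoints:
  fixes p q :: "'a::euclidean_space \<Rightarrow> real"
  assumes k: "k > 0" and p: "Ckc m p" and q: "Ckc n q"
  defines "Z \<equiv> (\<integral>x. gauss k x \<partial>(lborel :: 'a measure))"
  shows "mehler k p q 0 = Z * (\<integral>x. p x * gauss k x \<partial>lborel) * (\<integral>x. q x * gauss k x \<partial>lborel)"
    and "mehler k p q (pi / 2) = Z\<^sup>2 * (\<integral>x. p x * q x * gauss k x \<partial>lborel)"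
proof -
  have "(\<integral>w. (p (fst w) * gauss k (fst w)) * (q (snd w) * gauss k (snd w)) \<partial>lborel)
      = (\<integral>x. p x * gauss k x \<partial>lborel) * (\<integral>x. q x * gauss k x \<partial>lborel)"
    using p q by (intro integral_lborel_Pair_mult integrable_Ckc_gauss)
  moreover have "(p (fst w) * gauss k (fst w)) * (q (snd w) * gauss k (snd w)) = p (fst w) * q (snd w) * gauss k w" for w
    by (cases w) (simp add: gauss_Pair mult_ac)
  ultimately have "(\<integral>w. p (fst w) * q (snd w) * gauss k w \<partial>lborel)
      = (\<integral>x. p x * gauss k x \<partial>lborel) * (\<integral>x. q x * gauss k x \<partial>lborel)"
    by simp
  then show "mehler k p q 0 = Z * (\<integral>x. p x * gauss k x \<partial>lborel) * (\<integral>x. q x * gauss k x \<partial>lborel)"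
    unfolding mehler_unfold[OF k p q] by (simp add: Z_def)
  show "mehler k p q (pi / 2) = Z\<^sup>2 * (\<integral>x. p x * q x * gauss k x \<partial>lborel)"
  proof -
    have "mehler k p q (pi / 2) = (\<integral>z. Z\<^sup>2 * (p z * q z * gauss k z) \<partial>lborel)"
      unfolding mehler_unfold[OF k p q] by (simp add: integral_gauss_Pair[OF k] Z_def mult_ac)
    then show ?thesis by simp
  qed
qed

section \<open>The second-order Gaussian Poincare inequality\<close>

text \<open>The trapezoidal rule overestimates the integral of a convex function, here applied to
  \<open>C1\<close> in the variable \<open>sin\<^sup>2 t\<close>.\<close>

lemma trapezoid_sin_sq:
  fixes C C1 C2 C3 :: "real \<Rightarrow> real"
  assumes k: "k > 0"
    and C: "\<And>t. (C has_real_derivative sin (2 * t) / (2 * k) * C1 t) (at t)"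
    and C1: "\<And>t. (C1 has_real_derivative sin (2 * t) / (2 * k) * C2 t) (at t)"
    and C2: "\<And>t. (C2 has_real_derivative sin (2 * t) / (2 * k) * C3 t) (at t)"
    and C3: "\<And>t. C3 t \<ge> 0"
  shows "C (pi / 2) - C 0 \<le> (C1 0 + C1 (pi / 2)) / (4 * k)"
proof -
  have pos: "0 \<le> sin (2 * t)" if "0 \<le> t" "t \<le> pi / 2" for t
    using that by (intro sin_ge_zero) auto
  have S: "((\<lambda>t. (sin t)\<^sup>2) has_real_derivative sin (2 * t)) (at t)" for t
    by (auto intro!: derivative_eq_intros simp: sin_double)
  \<comment> \<open>In the variable s = sin^2 t, this is C1(0) minus the value at 0 of the tangent
    to C1 at s. Its s-derivative is s C1''(s), which is nonnegative.\<close>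
  define h where "h t = C1 0 - C1 t + (sin t)\<^sup>2 * C2 t / (2 * k)" for t
  have h: "(h has_real_derivative (sin t)\<^sup>2 * (sin (2 * t) / (2 * k) * C3 t) / (2 * k)) (at t)" for t
    unfolding h_def
    by (rule DERIV_cong, rule DERIV_add, rule DERIV_diff, rule DERIV_const, rule C1,
        rule DERIV_cdivide, rule DERIV_mult, rule S, rule C2) (use k in \<open>simp add: field_simps\<close>)
  have h_nonneg: "0 \<le> h t" if "0 \<le> t" "t \<le> pi / 2" for t
  proof -
    have "h 0 \<le> h t"
    proof (rule DERIV_nonneg_imp_nondecreasing[OF that(1)])
      fix x assume "0 \<le> x" "x \<le> t"
      then show "\<exists>y. DERIV h x :> y \<and> 0 \<le> y"
        using h[of x] pos[of x] C3[of x] k that by (intro exI conjI[OF h]) auto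
    qed
    then show ?thesis by (simp add: h_def)
  qed
  \<comment> \<open>Up to the constant C(0), the excess of the trapezoidal value on [0, s] over the
    increment of C; its s-derivative is h / (4 k).\<close>
  define g where "g t = (sin t)\<^sup>2 * (C1 0 + C1 t) / (4 * k) - C t" for t
  have g: "(g has_real_derivative sin (2 * t) / (4 * k) * h t) (at t)" for t
    unfolding g_def h_def
    by (rule DERIV_cong, rule DERIV_diff, rule DERIV_cdivide, rule DERIV_mult, rule S,
        rule DERIV_add, rule DERIV_const, rule C1, rule C) (use k in \<open>simp add: field_simps\<close>)
  have "g 0 \<le> g (pi / 2)"
  proof (rule DERIV_nonneg_imp_nondecreasing[of 0 "pi / 2" g])
    fix x assume "0 \<le> x" "x \<le> pi / 2"
    then show "\<exists>y. DERIV g x :> y \<and> 0 \<le> y"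
      using pos[of x] h_nonneg[of x] k by (intro exI[of _ "sin (2 * x) / (4 * k) * h x"] conjI[OF g]) auto
  qed simp
  then show ?thesis
    by (simp add: g_def)
qed

text \<open>The trapezoidal rule for \<open>mehler k f f\<close>, read off at the endpoints. Third
  derivatives of f enter only through the sign of C3; differentiating C2 takes second partials of
  class C^2, hence order 4. The powers of Z remain because the Gaussian is not normalised.\<close>

lemma gauss_second_order_poincare:
  fixes f :: "'a::euclidean_space \<Rightarrow> real"
  assumes k: "k > 0" and f: "Ckc 4 f"
  defines "Z \<equiv> (\<integral>x. gauss k x \<partial>(lborel :: 'a measure))"
  shows "Z * (Z * (\<integral>x. f x * f x * gauss k x \<partial>lborel) - (\<integral>x. f x * gauss k x \<partial>lborel)\<^sup>2)
    \<le> Z * ((\<Sum>i\<in>Basis. (\<integral>x. pd i f x * gauss k x \<partial>lborel)\<^sup>2)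
          + Z * (\<Sum>i\<in>Basis. \<integral>x. pd i f x * pd i f x * gauss k x \<partial>lborel)) / (4 * k)"
proof -
  define C1 where "C1 t = (\<Sum>i\<in>Basis. mehler k (pd i f) (pd i f) t)" for t
  define C2 where "C2 t = (\<Sum>i\<in>Basis. \<Sum>j\<in>Basis. mehler k (pd j (pd i f)) (pd j (pd i f)) t)" for t
  define C3 where "C3 t = (\<Sum>i\<in>Basis. \<Sum>j\<in>Basis. \<Sum>l\<in>Basis.
    mehler k (pd l (pd j (pd i f))) (pd l (pd j (pd i f))) t)" for t
  have f4: "Ckc (Suc (Suc (Suc (Suc 0)))) f"
    using f by (simp add: numeral_eq_Suc)
  note f3 = Ckc_pd[OF f4] and f2 = Ckc_pd[OF Ckc_pd[OF f4]] and f1 = Ckc_pd[OF Ckc_pd[OF Ckc_pd[OF f4]]]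
  have "mehler k f f (pi / 2) - mehler k f f 0 \<le> (C1 0 + C1 (pi / 2)) / (4 * k)"
  proof (rule trapezoid_sin_sq[OF k])
    show "(mehler k f f has_real_derivative sin (2 * t) / (2 * k) * C1 t) (at t)" for t
      unfolding C1_def by (rule DERIV_mehler[OF k f4 f4])
    show "(C1 has_real_derivative sin (2 * t) / (2 * k) * C2 t) (at t)" for t
      unfolding C1_def C2_def
      by (rule DERIV_cong[OF DERIV_sum[OF DERIV_mehler[OF k f3 f3]]]) (auto simp: sum_distrib_left)
    show "(C2 has_real_derivative sin (2 * t) / (2 * k) * C3 t) (at t)" for t
      unfolding C2_def C3_def
      by (rule DERIV_cong[OF DERIV_sum[OF DERIV_sum[OF DERIV_mehler[OF k f2 f2]]]])
         (auto simp: sum_distrib_left)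
    show "C3 t \<ge> 0" for t
      unfolding C3_def by (intro sum_nonneg mehler_nonneg[OF k f1])
  qed
  moreover have "C1 0 + C1 (pi / 2) = Z * ((\<Sum>i\<in>Basis. (\<integral>x. pd i f x * gauss k x \<partial>lborel)\<^sup>2)
          + Z * (\<Sum>i\<in>Basis. \<integral>x. pd i f x * pd i f x * gauss k x \<partial>lborel))"
    unfolding C1_def Z_def
    by (simp add: mehler_endpoints[OF k f3 f3] sum_distrib_left power2_eq_square distrib_left mult.assoc)
  ultimately show ?thesis
    by (simp add: mehler_endpoints[OF k f f] Z_def power2_eq_square algebra_simps)
qed

section \<open>Transfer from Gaussian to Lebesgue measure\<close>

lemma integral_pd_zero:
  assumes "Ckc (Suc n) g" "e \<in> Basis"
  shows "(\<integral>x. pd e g x \<partial>lborel) = 0"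
proof -
  have eq: "(\<Sum>i\<in>Basis. (e \<bullet> i) * pd i g x) = pd e g x" for x
    using sum_inner_Basis_scaleR[OF assms(2), of 1 "\<lambda>i. pd i g x"] by simp
  have c: "Ckc n (pd e g)"
    using assms by (rule Ckc_pd)
  have "(\<integral>x. (\<Sum>i\<in>Basis. (e \<bullet> i) * pd i g x) \<partial>lborel) = 0"
    by (rule integral_dir_deriv_zero[OF Ckc_has_derivative[OF assms(1)] Ckc_integrable[OF assms(1)]])
       (unfold eq, rule Ckc_gdom[OF c], rule Ckc_continuous[OF c])
  then show ?thesis
    by (simp add: eq)
qed

text \<open>The divergence of the field f^2 x integrates to 0; each coordinate contributes - 1/2
  times the integral of f^2.\<close>

lemma integral_radial_deriv:
  fixes f :: "'a::euclidean_space \<Rightarrow> real"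
  assumes f: "Ckc (Suc n) f"
  shows "(\<Sum>i\<in>Basis. \<integral>x. (x \<bullet> i) * (f x * pd i f x) \<partial>lborel) = - real DIM('a) / 2 * (\<integral>x. (f x)\<^sup>2 \<partial>lborel)"
proof -
  have "(\<integral>x. (x \<bullet> i) * (f x * pd i f x) \<partial>lborel) = - (\<integral>x. (f x)\<^sup>2 \<partial>lborel) / 2" if i: "i \<in> Basis" for i
  proof -
    have f0: "Ckc n f" and f1: "Ckc n (pd i f)"
      using f Ckc_Suc_imp Ckc_pd i by auto
    have ff: "Ckc (Suc n) (\<lambda>x. f x * f x)"
      using f by (intro Ckc_mult Ckc_imp_Ck)
    have df: "f differentiable (at x)" "(\<lambda>x. f x * f x) differentiable (at x)" "(\<lambda>x. x \<bullet> i) differentiable (at x)" for x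
      using f ff Ck_inner[of "Suc n" i] by (auto simp: Ckc_def)
    have eq: "pd i (\<lambda>x. (x \<bullet> i) * (f x * f x)) x = 2 * ((x \<bullet> i) * (f x * pd i f x)) + (f x)\<^sup>2" for x
      using i by (simp add: pd_mult df pd_inner inner_Basis power2_eq_square)
    have I: "integrable lborel (\<lambda>x. (x \<bullet> i) * (f x * pd i f x))" "integrable lborel (\<lambda>x. f x * f x)"
      using f0 f1 by (intro Ckc_integrable[of n] Ckc_mult_left[OF Ck_inner] Ckc_mult Ckc_imp_Ck; simp)+
    have "0 = (\<integral>x. pd i (\<lambda>x. (x \<bullet> i) * (f x * f x)) x \<partial>lborel)"
      using ff i by (intro integral_pd_zero[symmetric] Ckc_mult_left[OF Ck_inner])
    also have "\<dots> = 2 * (\<integral>x. (x \<bullet> i) * (f x * pd i f x) \<partial>lborel) + (\<integral>x. (f x)\<^sup>2 \<partial>lborel)"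
      unfolding eq using I by (simp add: power2_eq_square)
    finally show ?thesis by simp
  qed
  then show ?thesis by simp
qed

text \<open>Substituting \<open>f = v exp (- k |x|\<^sup>2 / 2)\<close> turns the Gaussian inequality for \<open>v\<close> into one
  for \<open>f\<close> with respect to Lebesgue measure.\<close>

lemma second_order_hup_Ckc:
  fixes f :: "'a::euclidean_space \<Rightarrow> real"
  assumes k: "k > 0" and f: "Ckc 4 f"
  defines "Z \<equiv> (\<integral>x. gauss k x \<partial>(lborel :: 'a measure))"
  shows "2 * (\<integral>x. (f x)\<^sup>2 \<partial>lborel) - 2 / Z * (\<integral>x. f x * gauss (k / 2) x \<partial>lborel)\<^sup>2
      - 2 * k / Z * (\<Sum>i\<in>Basis. (\<integral>x. f x * ((x \<bullet> i) * gauss (k / 2) x) \<partial>lborel)\<^sup>2)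
    \<le> 1 / (2 * k) * (\<Sum>i\<in>Basis. \<integral>x. (pd i f x)\<^sup>2 \<partial>lborel) + k / 2 * (\<integral>x. (f x)\<^sup>2 * (norm x)\<^sup>2 \<partial>lborel)
      - real DIM('a) / 2 * (\<integral>x. (f x)\<^sup>2 \<partial>lborel)"
proof -
  \<comment> \<open>The negative parameter makes this weight the inverse of
    \<open>gauss (k / 2)\<close>; bounded support keeps v in the same class as f.\<close>
  define v where "v x = f x * gauss (- k / 2) x" for x
  have v: "Ckc 4 v"
    unfolding v_def by (intro Ckc_mult f Ck_gauss)
  have f3: "Ckc 3 (pd i f)" "Ckc 3 (pd i v)" if "i \<in> Basis" for i
    using f v that by (auto intro!: Ckc_pd simp: numeral_eq_Suc)
  have f3': "Ckc 3 f" and v': "Ckc (Suc 3) v"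
    using f v by (auto intro: Ckc_mono)
  have gm: "gauss (- k / 2) x * gauss k x = gauss (k / 2) x" "gauss (- k / 2) x * gauss (k / 2) x = 1" for x :: 'a
    unfolding gauss_mult by (auto simp: gauss_def)
  have vv: "v x * v x * gauss k x = (f x)\<^sup>2" and vg: "v x * gauss k x = f x * gauss (k / 2) x" for x
    using gm[of x] by (auto simp: v_def power2_eq_square)
  have df: "f differentiable (at x)" "gauss l differentiable (at x)" for x l
    using f Ck_gauss[of "Suc 0" l] by (auto simp: Ckc_def numeral_eq_Suc)
  have pdv: "pd i v x = (pd i f x + k * ((x \<bullet> i) * f x)) * gauss (- k / 2) x" for i x
    unfolding v_def by (simp add: pd_mult df pd_gauss algebra_simps)
  have pdvv: "pd i v x * pd i v x * gauss k x = (pd i f x)\<^sup>2 + k\<^sup>2 * ((f x)\<^sup>2 * (x \<bullet> i)\<^sup>2) + 2 * k * ((x \<bullet> i) * (f x * pd i f x))" for i x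
  proof -
    have "pd i v x * pd i v x * gauss k x = (pd i f x + k * ((x \<bullet> i) * f x))\<^sup>2
      * (gauss (- k / 2) x * (gauss (- k / 2) x * gauss k x))"
      unfolding pdv by (simp add: power2_eq_square mult_ac)
    then show ?thesis
      unfolding gm by (simp add: power2_eq_square algebra_simps)
  qed
  have I: "integrable lborel (\<lambda>x. (pd i f x)\<^sup>2)" "integrable lborel (\<lambda>x. (f x)\<^sup>2 * (x \<bullet> i)\<^sup>2)"
    "integrable lborel (\<lambda>x. (x \<bullet> i) * (f x * pd i f x))" if "i \<in> Basis" for i
    unfolding power2_eq_square using f3[OF that] f3'
    by (intro Ckc_integrable[of 3] Ckc_mult_left[OF Ck_inner] Ckc_mult Ck_mult Ck_inner Ckc_imp_Ck; simp)+
  \<comment> \<open>The cross term of |grad f + k x f|^2 is 2 k f (x \<bullet> grad f). Its integral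
    is - k N times that of f^2, the source of the term with N / 2 in \<open>delta1\<close>.\<close>
  have e1: "(\<Sum>i\<in>Basis. \<integral>x. pd i v x * pd i v x * gauss k x \<partial>lborel) = (\<Sum>i\<in>Basis. \<integral>x. (pd i f x)\<^sup>2 \<partial>lborel)
      + k\<^sup>2 * (\<integral>x. (f x)\<^sup>2 * (norm x)\<^sup>2 \<partial>lborel) - k * real DIM('a) * (\<integral>x. (f x)\<^sup>2 \<partial>lborel)"
  proof -
    have "(\<Sum>i\<in>Basis. \<integral>x. pd i v x * pd i v x * gauss k x \<partial>lborel) = (\<Sum>i\<in>Basis. \<integral>x. (pd i f x)\<^sup>2 \<partial>lborel)
      + k\<^sup>2 * (\<Sum>i\<in>Basis. \<integral>x. (f x)\<^sup>2 * (x \<bullet> i)\<^sup>2 \<partial>lborel)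
      + 2 * k * (\<Sum>i\<in>Basis. \<integral>x. (x \<bullet> i) * (f x * pd i f x) \<partial>lborel)"
      unfolding pdvv by (simp add: I sum.distrib sum_distrib_left)
    also have "(\<Sum>i\<in>Basis. \<integral>x. (f x)\<^sup>2 * (x \<bullet> i)\<^sup>2 \<partial>lborel) = (\<integral>x. (f x)\<^sup>2 * (norm x)\<^sup>2 \<partial>lborel)"
      unfolding norm_sq_Basis sum_distrib_left by (simp add: I)
    also have "(\<Sum>i\<in>Basis. \<integral>x. (x \<bullet> i) * (f x * pd i f x) \<partial>lborel) = - real DIM('a) / 2 * (\<integral>x. (f x)\<^sup>2 \<partial>lborel)"
      using f by (intro integral_radial_deriv[of 3]) (simp add: numeral_eq_Suc)
    finally show ?thesis by simp
  qed
  \<comment> \<open>With the derivative moved off v only moments of f are left, and these are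
    continuous in L^2.\<close>
  have e2: "(\<integral>x. pd i v x * gauss k x \<partial>lborel) = 2 * k * (\<integral>x. f x * ((x \<bullet> i) * gauss (k / 2) x) \<partial>lborel)"
    if i: "i \<in> Basis" for i
  proof -
    have eq: "(\<Sum>j\<in>Basis. (i \<bullet> j) * pd j v x) = pd i v x" for x
      using sum_inner_Basis_scaleR[OF i, of 1 "\<lambda>j. pd j v x"] by simp
    obtain V V' where V: "\<And>x. \<bar>v x\<bar> \<le> V" "\<And>x. \<bar>pd i v x\<bar> \<le> V'"
      using Ckc_bdd[OF v] Ckc_bdd[OF f3(2)[OF i]] by blast
    have "(\<integral>x. (\<Sum>j\<in>Basis. (i \<bullet> j) * pd j v x) * gauss k x \<partial>lborel) = 2 * k * (\<integral>x. (x \<bullet> i) * (v x * gauss k x) \<partial>lborel)"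
      by (rule gauss_ibp[OF k Ckc_has_derivative[OF v']])
         (unfold eq, rule Ckc_continuous[OF f3(2)[OF i]], rule lin_growth_bounded[OF V(1)], rule lin_growth_bounded[OF V(2)])
    then show ?thesis
      unfolding eq vg by (simp add: mult_ac)
  qed
  have Z: "Z > 0"
    unfolding Z_def by (rule integral_gauss_pos[OF k])
  let ?A = "\<integral>x. (f x)\<^sup>2 \<partial>lborel" and ?B = "(\<integral>x. f x * gauss (k / 2) x \<partial>lborel)\<^sup>2"
    and ?S = "\<Sum>i\<in>Basis. (\<integral>x. f x * ((x \<bullet> i) * gauss (k / 2) x) \<partial>lborel)\<^sup>2"
    and ?G = "\<Sum>i\<in>Basis. \<integral>x. (pd i f x)\<^sup>2 \<partial>lborel" and ?X = "\<integral>x. (f x)\<^sup>2 * (norm x)\<^sup>2 \<partial>lborel"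
  have "Z * (Z * ?A - ?B) \<le> Z * (4 * k\<^sup>2 * ?S + Z * (?G + k\<^sup>2 * ?X - k * real DIM('a) * ?A)) / (4 * k)"
    using gauss_second_order_poincare[OF k v] unfolding vv vg e1 Z_def[symmetric]
    by (simp add: e2 power_mult_distrib sum_distrib_left mult.assoc)
  then have "Z * ?A - ?B \<le> (4 * k\<^sup>2 * ?S + Z * (?G + k\<^sup>2 * ?X - k * real DIM('a) * ?A)) / (4 * k)"
    using Z by (simp add: mult_le_cancel_left_pos times_divide_eq_right[symmetric] del: times_divide_eq_right)
  \<comment> \<open>The factor 2 / Z produces twice the squared distance to the multiples of the
    Gaussian on the left, and 1 / (2 k) times the energy on the right.\<close>
  then have "2 / Z * (Z * ?A - ?B) \<le> 2 / Z * ((4 * k\<^sup>2 * ?S + Z * (?G + k\<^sup>2 * ?X - k * real DIM('a) * ?A)) / (4 * k))"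
    using Z by (intro mult_left_mono) auto
  also have "\<dots> = 2 * k / Z * ?S + (1 / (2 * k) * ?G + k / 2 * ?X - real DIM('a) / 2 * ?A)"
    using Z k by (simp add: field_simps power2_eq_square)
  also have "2 / Z * (Z * ?A - ?B) = 2 * ?A - 2 / Z * ?B"
    using Z by (simp add: field_simps)
  finally show ?thesis
    by linarith
qed

section \<open>Passage to the limit in L^2\<close>

definition sq_int :: "'b measure \<Rightarrow> ('b \<Rightarrow> real) \<Rightarrow> bool" where
  "sq_int M f \<longleftrightarrow> f \<in> borel_measurable M \<and> integrable M (\<lambda>x. (f x)\<^sup>2)"

lemma sq_int_mult:
  assumes "sq_int M f" "sq_int M g"
  shows "integrable M (\<lambda>x. f x * g x)"
proof (rule Bochner_Integration.integrable_bound)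
  show "integrable M (\<lambda>x. (f x)\<^sup>2 + (g x)\<^sup>2)"
    using assms by (simp add: sq_int_def)
  have "\<bar>a * b\<bar> \<le> a\<^sup>2 + b\<^sup>2" for a b :: real
    using zero_le_power2[of "a - b"] zero_le_power2[of "a + b"]
    by (simp add: power2_diff power2_sum abs_le_iff)
  then show "AE x in M. norm (f x * g x) \<le> norm ((f x)\<^sup>2 + (g x)\<^sup>2)"
    by (simp add: order_trans[OF _ abs_ge_self])
qed (use assms in \<open>auto simp: sq_int_def\<close>)

lemma sq_int_add:
  assumes "sq_int M f" "sq_int M g"
  shows "sq_int M (\<lambda>x. f x + g x)"
  using assms sq_int_mult[OF assms] by (auto simp: sq_int_def power2_sum mult.assoc intro!: borel_measurable_add)

lemma sq_int_cmult: "sq_int M f \<Longrightarrow> sq_int M (\<lambda>x. c * f x)"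
  by (auto simp: sq_int_def power_mult_distrib intro!: borel_measurable_times)

lemma sq_int_diff: "sq_int M f \<Longrightarrow> sq_int M g \<Longrightarrow> sq_int M (\<lambda>x. f x - g x)"
  using sq_int_add[of M f "\<lambda>x. (- 1) * g x"] sq_int_cmult[of M g "- 1"] by simp

text \<open>The integral of (f + t g)^2 is a nonnegative quadratic polynomial in t, which bounds its
  discriminant.\<close>

lemma sq_int_Cauchy_Schwarz:
  assumes "sq_int M f" "sq_int M g"
  shows "\<bar>\<integral>x. f x * g x \<partial>M\<bar> \<le> sqrt (\<integral>x. (f x)\<^sup>2 \<partial>M) * sqrt (\<integral>x. (g x)\<^sup>2 \<partial>M)"
proof -
  let ?A = "\<integral>x. (f x)\<^sup>2 \<partial>M" and ?B = "\<integral>x. (g x)\<^sup>2 \<partial>M" and ?C = "\<integral>x. f x * g x \<partial>M"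
  have q: "0 \<le> ?A + 2 * t * ?C + t\<^sup>2 * ?B" for t
  proof -
    have "0 \<le> (\<integral>x. (f x + t * g x)\<^sup>2 \<partial>M)" by simp
    also have "\<dots> = (\<integral>x. (f x)\<^sup>2 + 2 * t * (f x * g x) + t\<^sup>2 * (g x)\<^sup>2 \<partial>M)"
      by (simp add: power2_sum power_mult_distrib ac_simps)
    also have "\<dots> = ?A + 2 * t * ?C + t\<^sup>2 * ?B"
      using assms sq_int_mult[OF assms] by (simp add: sq_int_def)
    finally show ?thesis .
  qed
  have "?C\<^sup>2 \<le> ?A * ?B"
  proof (cases "?B = 0")
    case True
    have "?C = 0"
    proof (rule ccontr)
      assume "?C \<noteq> 0"
      \<comment> \<open>This t gives the polynomial, which is affine here, the value - 1.\<close>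
      then show False
        using q[of "- (?A + 1) / (2 * ?C)"] True by (simp add: field_simps)
    qed
    then show ?thesis using True by simp
  next
    case False
    moreover have "?B \<ge> 0" by simp
    ultimately have B: "?B > 0" by linarith
    \<comment> \<open>Evaluated at the minimiser t = - ?C / ?B.\<close>
    have "0 \<le> ?B * (?A + 2 * (- ?C / ?B) * ?C + (- ?C / ?B)\<^sup>2 * ?B)"
      using q[of "- ?C / ?B"] B by (intro mult_nonneg_nonneg) auto
    also have "\<dots> = ?A * ?B - ?C\<^sup>2"
      using B by (simp add: field_simps power2_eq_square)
    finally show ?thesis by simp
  qed
  then have "sqrt (?C\<^sup>2) \<le> sqrt (?A * ?B)"
    by (rule real_sqrt_le_mono)
  then show ?thesis by (simp add: real_sqrt_mult)
qed

lemma sq_int_tendsto_mult: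
  assumes fn: "\<And>n. sq_int M (fn n)" and f: "sq_int M f" and g: "sq_int M g"
    and lim: "(\<lambda>n. \<integral>x. (fn n x - f x)\<^sup>2 \<partial>M) \<longlonglongrightarrow> 0"
  shows "(\<lambda>n. \<integral>x. fn n x * g x \<partial>M) \<longlonglongrightarrow> (\<integral>x. f x * g x \<partial>M)"
proof -
  have "(\<lambda>n. (\<integral>x. fn n x * g x \<partial>M) - (\<integral>x. f x * g x \<partial>M)) \<longlonglongrightarrow> 0"
  proof (rule tendsto_rabs_zero_cancel, rule tendsto_sandwich[OF _ _ tendsto_const])
    show "\<forall>\<^sub>F n in sequentially. \<bar>(\<integral>x. fn n x * g x \<partial>M) - (\<integral>x. f x * g x \<partial>M)\<bar>
        \<le> sqrt (\<integral>x. (fn n x - f x)\<^sup>2 \<partial>M) * sqrt (\<integral>x. (g x)\<^sup>2 \<partial>M)"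
    proof (rule always_eventually, rule allI)
      fix n
      have "(\<integral>x. fn n x * g x \<partial>M) - (\<integral>x. f x * g x \<partial>M) = (\<integral>x. (fn n x - f x) * g x \<partial>M)"
        using sq_int_mult[OF fn g, of n] sq_int_mult[OF f g] by (simp add: left_diff_distrib)
      then show "\<bar>(\<integral>x. fn n x * g x \<partial>M) - (\<integral>x. f x * g x \<partial>M)\<bar>
        \<le> sqrt (\<integral>x. (fn n x - f x)\<^sup>2 \<partial>M) * sqrt (\<integral>x. (g x)\<^sup>2 \<partial>M)"
        using sq_int_Cauchy_Schwarz[OF sq_int_diff[OF fn f] g, of n] by simp
    qed
    show "(\<lambda>n. sqrt (\<integral>x. (fn n x - f x)\<^sup>2 \<partial>M) * sqrt (\<integral>x. (g x)\<^sup>2 \<partial>M)) \<longlonglongrightarrow> 0"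
      using tendsto_mult_left_zero[OF tendsto_real_sqrt[OF lim, simplified]] .
  qed simp
  then show ?thesis
    by (simp add: LIM_zero_iff)
qed

lemma sq_int_tendsto_sq:
  assumes fn: "\<And>n. sq_int M (fn n)" and f: "sq_int M f"
    and lim: "(\<lambda>n. \<integral>x. (fn n x - f x)\<^sup>2 \<partial>M) \<longlonglongrightarrow> 0"
  shows "(\<lambda>n. \<integral>x. (fn n x)\<^sup>2 \<partial>M) \<longlonglongrightarrow> (\<integral>x. (f x)\<^sup>2 \<partial>M)"
proof -
  have "(\<integral>x. (fn n x)\<^sup>2 \<partial>M) = (\<integral>x. (fn n x - f x)\<^sup>2 \<partial>M) + 2 * (\<integral>x. fn n x * f x \<partial>M) - (\<integral>x. f x * f x \<partial>M)" for n
  proof -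
    have "(fn n x)\<^sup>2 = (fn n x - f x)\<^sup>2 + 2 * (fn n x * f x) - f x * f x" for x
      by (simp add: power2_eq_square algebra_simps)
    then have "(\<integral>x. (fn n x)\<^sup>2 \<partial>M) = (\<integral>x. (fn n x - f x)\<^sup>2 + 2 * (fn n x * f x) - f x * f x \<partial>M)"
      by simp
    then show ?thesis
      using sq_int_diff[OF fn f, of n] sq_int_mult[OF fn f, of n] sq_int_mult[OF f f]
      by (simp add: sq_int_def)
  qed
  moreover have "(\<lambda>n. (\<integral>x. (fn n x - f x)\<^sup>2 \<partial>M) + 2 * (\<integral>x. fn n x * f x \<partial>M) - (\<integral>x. f x * f x \<partial>M))
     \<longlonglongrightarrow> 0 + 2 * (\<integral>x. f x * f x \<partial>M) - (\<integral>x. f x * f x \<partial>M)"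
    by (intro tendsto_intros lim sq_int_tendsto_mult[OF fn f f lim])
  ultimately show ?thesis
    by (simp add: power2_eq_square)
qed

section \<open>Approximation by test functions\<close>

lemma Ckc_sq_int: "Ckc n f \<Longrightarrow> sq_int lborel f"
  unfolding sq_int_def power2_eq_square
  using Ckc_measurable[of n f] by (auto intro!: Ckc_integrable[of n] Ckc_mult Ckc_imp_Ck)

lemma Ckc_sq_int_norm: "Ckc n f \<Longrightarrow> sq_int lborel (\<lambda>x. f x * norm x)"
proof -
  assume f: "Ckc n f"
  have "Ckc 0 (\<lambda>x. f x * norm x)"
    using Ckc_mono[OF f, of 0] by (rule Ckc_mult) (auto intro!: continuous_intros)
  then show ?thesis by (rule Ckc_sq_int)
qed

text \<open>Integrate |grad f + x f|^2 \<ge> 0 and evaluate the cross term by the radial identity.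
  The factor N is weakened to 1: a crude bound of the L^2 norm by the S_0 norm suffices to transfer
  the Cauchy property.\<close>

lemma hup_Ckc:
  fixes f :: "'a::euclidean_space \<Rightarrow> real"
  assumes f: "Ckc (Suc n) f"
  shows "(\<integral>x. (f x)\<^sup>2 \<partial>lborel) \<le> (\<Sum>i\<in>Basis. \<integral>x. (pd i f x)\<^sup>2 \<partial>lborel) + (\<integral>x. (f x * norm x)\<^sup>2 \<partial>lborel)"
proof -
  have f0: "Ckc n f" and f1: "Ckc n (pd i f)" if "i \<in> Basis" for i
    using f Ckc_Suc_imp Ckc_pd that by auto
  have If: "integrable lborel (\<lambda>x. (x \<bullet> i)\<^sup>2 * (f x)\<^sup>2)" for i
    unfolding power2_eq_square using Ckc_Suc_imp[OF f]
    by (intro Ckc_integrable[of n] Ckc_mult_left Ck_mult Ck_inner Ckc_mult Ckc_imp_Ck; simp)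
  have "- 2 * (\<integral>x. (x \<bullet> i) * (f x * pd i f x) \<partial>lborel) \<le> (\<integral>x. (pd i f x)\<^sup>2 \<partial>lborel) + (\<integral>x. (x \<bullet> i)\<^sup>2 * (f x)\<^sup>2 \<partial>lborel)"
    if i: "i \<in> Basis" for i
  proof -
    have I: "integrable lborel (\<lambda>x. (pd i f x)\<^sup>2)" "integrable lborel (\<lambda>x. (x \<bullet> i) * (f x * pd i f x))"
      unfolding power2_eq_square using f0[OF i] f1[OF i]
      by (intro Ckc_integrable[of n] Ckc_mult_left[OF Ck_inner] Ckc_mult Ckc_imp_Ck; simp)+
    have "0 \<le> (\<integral>x. (pd i f x + (x \<bullet> i) * f x)\<^sup>2 \<partial>lborel)" by simp
    also have "\<dots> = (\<integral>x. (pd i f x)\<^sup>2 + (x \<bullet> i)\<^sup>2 * (f x)\<^sup>2 + 2 * ((x \<bullet> i) * (f x * pd i f x)) \<partial>lborel)"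
      by (simp add: power2_sum power_mult_distrib mult_ac)
    also have "\<dots> = (\<integral>x. (pd i f x)\<^sup>2 \<partial>lborel) + (\<integral>x. (x \<bullet> i)\<^sup>2 * (f x)\<^sup>2 \<partial>lborel) + 2 * (\<integral>x. (x \<bullet> i) * (f x * pd i f x) \<partial>lborel)"
      using I If by simp
    finally show ?thesis by simp
  qed
  then have "(\<Sum>i\<in>Basis. - 2 * (\<integral>x. (x \<bullet> i) * (f x * pd i f x) \<partial>lborel))
      \<le> (\<Sum>i\<in>Basis. (\<integral>x. (pd i f x)\<^sup>2 \<partial>lborel) + (\<integral>x. (x \<bullet> i)\<^sup>2 * (f x)\<^sup>2 \<partial>lborel))"
    by (rule sum_mono)
  moreover have "(\<Sum>i\<in>Basis. - 2 * (\<integral>x. (x \<bullet> i) * (f x * pd i f x) \<partial>lborel)) = real DIM('a) * (\<integral>x. (f x)\<^sup>2 \<partial>lborel)"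
    unfolding sum_distrib_left[symmetric] integral_radial_deriv[OF f] by simp
  moreover have "(\<Sum>i\<in>Basis. \<integral>x. (x \<bullet> i)\<^sup>2 * (f x)\<^sup>2 \<partial>lborel) = (\<integral>x. (f x * norm x)\<^sup>2 \<partial>lborel)"
    using If by (simp add: power_mult_distrib norm_sq_Basis sum_distrib_left mult.commute)
  moreover have "1 * (\<integral>x. (f x)\<^sup>2 \<partial>lborel) \<le> real DIM('a) * (\<integral>x. (f x)\<^sup>2 \<partial>lborel)"
    using DIM_positive[where 'a = 'a] by (intro mult_right_mono) (auto simp: Suc_le_eq)
  ultimately show ?thesis
    by (simp add: sum.distrib)
qed

lemma square_diff_le: "(a - b)\<^sup>2 \<le> 2 * (a - c)\<^sup>2 + 2 * (b - c :: real)\<^sup>2"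
  using zero_le_power2[of "(a - c) + (b - c)"] by (simp add: power2_eq_square algebra_simps)

lemma integral_square_diff_le:
  assumes "sq_int M f" "sq_int M g" "sq_int M h"
  shows "(\<integral>x. (f x - g x)\<^sup>2 \<partial>M) \<le> 2 * (\<integral>x. (f x - h x)\<^sup>2 \<partial>M) + 2 * (\<integral>x. (g x - h x)\<^sup>2 \<partial>M)"
proof -
  have I: "integrable M (\<lambda>x. (f x - g x)\<^sup>2)" "integrable M (\<lambda>x. (f x - h x)\<^sup>2)" "integrable M (\<lambda>x. (g x - h x)\<^sup>2)"
    using sq_int_diff[OF assms(1,2)] sq_int_diff[OF assms(1,3)] sq_int_diff[OF assms(2,3)] by (auto simp: sq_int_def)
  have "(\<integral>x. (f x - g x)\<^sup>2 \<partial>M) \<le> (\<integral>x. 2 * (f x - h x)\<^sup>2 + 2 * (g x - h x)\<^sup>2 \<partial>M)"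
    using I by (intro integral_mono square_diff_le) auto
  then show ?thesis using I by simp
qed

text \<open>The uncertainty principle makes the approximating sequence Cauchy in \<open>L\<^sup>2\<close>; Fatou's lemma
  along an a.e. convergent subsequence identifies the limit with \<open>u\<close>.\<close>

lemma Ckc_approx_sq_int:
  fixes u :: "'a::euclidean_space \<Rightarrow> real" and g :: "'a \<Rightarrow> 'a \<Rightarrow> real"
  assumes f: "\<And>n. Ckc (Suc 0) (f n)"
    and g: "\<And>i. i \<in> Basis \<Longrightarrow> sq_int lborel (g i)"
    and u: "u \<in> borel_measurable lborel" "sq_int lborel (\<lambda>x. u x * norm x)"
    and lim1: "\<And>i. i \<in> Basis \<Longrightarrow> (\<lambda>n. \<integral>x. (pd i (f n) x - g i x)\<^sup>2 \<partial>lborel) \<longlonglongrightarrow> 0"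
    and lim2: "(\<lambda>n. \<integral>x. (f n x * norm x - u x * norm x)\<^sup>2 \<partial>lborel) \<longlonglongrightarrow> 0"
  shows "sq_int lborel u" "(\<lambda>n. \<integral>x. (f n x - u x)\<^sup>2 \<partial>lborel) \<longlonglongrightarrow> 0"
proof -
  define e where "e n = (\<Sum>i\<in>Basis. \<integral>x. (pd i (f n) x - g i x)\<^sup>2 \<partial>lborel)
      + (\<integral>x. (f n x * norm x - u x * norm x)\<^sup>2 \<partial>lborel)" for n
  have e0: "e \<longlonglongrightarrow> 0"
    unfolding e_def using tendsto_add[OF tendsto_sum[OF lim1] lim2] by simp
  have f1: "Ckc 0 (pd i (f n))" if "i \<in> Basis" for i n
    using f that by (intro Ckc_pd)
  have cauchy: "(\<integral>x. (f m x - f n x)\<^sup>2 \<partial>lborel) \<le> 2 * e m + 2 * e n" for m n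
  proof -
    have pd: "pd i (\<lambda>x. f m x - f n x) x = pd i (f m) x - pd i (f n) x" for i x
      using f by (intro pd_diff) (auto simp: Ckc_def)
    have "(\<integral>x. (f m x - f n x)\<^sup>2 \<partial>lborel) \<le> (\<Sum>i\<in>Basis. \<integral>x. (pd i (f m) x - pd i (f n) x)\<^sup>2 \<partial>lborel)
        + (\<integral>x. (f m x * norm x - f n x * norm x)\<^sup>2 \<partial>lborel)"
      using hup_Ckc[OF Ckc_diff[OF f[of m] f[of n]]] by (simp add: pd left_diff_distrib)
    also have "\<dots> \<le> (\<Sum>i\<in>Basis. 2 * (\<integral>x. (pd i (f m) x - g i x)\<^sup>2 \<partial>lborel) + 2 * (\<integral>x. (pd i (f n) x - g i x)\<^sup>2 \<partial>lborel))
        + (2 * (\<integral>x. (f m x * norm x - u x * norm x)\<^sup>2 \<partial>lborel) + 2 * (\<integral>x. (f n x * norm x - u x * norm x)\<^sup>2 \<partial>lborel))"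
      by (intro add_mono sum_mono integral_square_diff_le Ckc_sq_int[OF f1] Ckc_sq_int_norm[OF f] g u)
    also have "\<dots> = 2 * e m + 2 * e n"
      by (simp add: e_def sum.distrib sum_distrib_left)
    finally show ?thesis .
  qed
  have [measurable]: "u \<in> borel_measurable borel" "f n \<in> borel_measurable borel" for n
    using u Ckc_measurable[OF f] by auto
  \<comment> \<open>So far only the functions weighted by \<open>norm x\<close> converge in L^2.
    Their almost everywhere limit is divided by the weight; the origin is a null set.\<close>
  obtain r where r: "strict_mono r"
    and AE0: "AE x in lborel. (\<lambda>n. (f (r n) x * norm x - u x * norm x)\<^sup>2) \<longlonglongrightarrow> 0"
    using tendsto_L1_AE_subseq[of lborel "\<lambda>n x. (f n x * norm x - u x * norm x)\<^sup>2"] lim2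
      sq_int_diff[OF Ckc_sq_int_norm[OF f] u(2)] by (auto simp: sq_int_def)
  have AE: "AE x in lborel. (\<lambda>n. f (r n) x) \<longlonglongrightarrow> u x"
    using AE0 AE_lborel_singleton[of "0::'a"]
  proof eventually_elim
    case (elim x)
    have "(\<lambda>n. sqrt ((f (r n) x * norm x - u x * norm x)\<^sup>2)) \<longlonglongrightarrow> sqrt 0"
      by (rule tendsto_real_sqrt[OF elim(1)])
    then have "(\<lambda>n. f (r n) x * norm x - u x * norm x) \<longlonglongrightarrow> 0"
      by (simp add: tendsto_rabs_zero_iff)
    then have "(\<lambda>n. (f (r n) x * norm x - u x * norm x) / norm x + u x) \<longlonglongrightarrow> 0 / norm x + u x"
      using elim(2) by (intro tendsto_intros) auto
    then show ?case
      using elim(2) by (simp add: diff_divide_distrib)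
  qed
  \<comment> \<open>Fatou's lemma along r in the Cauchy estimate. Square integrability of u is still
    open here, so the estimate is made for nonnegative integrals, and its finiteness then decides
    the question.\<close>
  have bound: "(\<integral>\<^sup>+x. ennreal ((f m x - u x)\<^sup>2) \<partial>lborel) \<le> ennreal (2 * e m)" for m
  proof -
    have "(\<integral>\<^sup>+x. ennreal ((f m x - u x)\<^sup>2) \<partial>lborel) = (\<integral>\<^sup>+x. liminf (\<lambda>n. ennreal ((f m x - f (r n) x)\<^sup>2)) \<partial>lborel)"
    proof (rule nn_integral_cong_AE, use AE in eventually_elim)
      case (elim x)
      have "(\<lambda>n. ennreal ((f m x - f (r n) x)\<^sup>2)) \<longlonglongrightarrow> ennreal ((f m x - u x)\<^sup>2)"
        by (intro tendsto_intros elim)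
      then show ?case
        using lim_imp_Liminf by (metis sequentially_bot)
    qed
    also have "\<dots> \<le> liminf (\<lambda>n. \<integral>\<^sup>+x. ennreal ((f m x - f (r n) x)\<^sup>2) \<partial>lborel)"
      by (intro nn_integral_liminf) measurable
    also have "\<dots> \<le> liminf (\<lambda>n. ennreal (2 * e m + 2 * e (r n)))"
    proof (intro Liminf_mono always_eventually allI)
      fix n
      have "integrable lborel (\<lambda>x. (f m x - f (r n) x)\<^sup>2)"
        using Ckc_sq_int[OF Ckc_diff[OF f f]] by (simp add: sq_int_def)
      then show "(\<integral>\<^sup>+x. ennreal ((f m x - f (r n) x)\<^sup>2) \<partial>lborel) \<le> ennreal (2 * e m + 2 * e (r n))"
        by (subst nn_integral_eq_integral) (auto intro: ennreal_leI cauchy)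
    qed
    also have "\<dots> = ennreal (2 * e m + 2 * 0)"
      by (intro lim_imp_Liminf tendsto_intros tendsto_ennrealI LIMSEQ_subseq_LIMSEQ[OF e0 r, unfolded comp_def]) simp
    finally show ?thesis by simp
  qed
  have d: "integrable lborel (\<lambda>x. (f m x - u x)\<^sup>2)" for m
    using bound[of m] by (intro integrableI_nonneg) (auto intro: le_less_trans)
  then have "sq_int lborel (\<lambda>x. f 0 x - u x)"
    by (simp add: sq_int_def)
  from sq_int_diff[OF Ckc_sq_int[OF f[of 0]] this] show "sq_int lborel u"
    by simp
  have e_nonneg: "e m \<ge> 0" for m
    unfolding e_def by (intro add_nonneg_nonneg sum_nonneg) auto
  have "(\<integral>x. (f m x - u x)\<^sup>2 \<partial>lborel) \<le> 2 * e m" for m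
    using bound[of m] e_nonneg[of m] d[of m] by (subst (asm) nn_integral_eq_integral) auto
  then show "(\<lambda>n. \<integral>x. (f n x - u x)\<^sup>2 \<partial>lborel) \<longlonglongrightarrow> 0"
    by (intro tendsto_sandwich[OF _ _ tendsto_const tendsto_mult_right_zero[OF e0]] always_eventually allI) auto
qed

section \<open>Projection onto Gaussians and the stability estimates\<close>

lemma sq_int_inner_gauss:
  assumes "k > 0"
  shows "sq_int lborel (\<lambda>x. (x \<bullet> e) * gauss k x)"
proof -
  have "integrable lborel (\<lambda>x. (x \<bullet> e) * ((x \<bullet> e) * gauss (2 * k) x))"
    using assms by (intro gdom_integrable gdom_mult_lin_growth lin_growth_inner gdom_gauss) auto
  moreover have "((x \<bullet> e) * gauss k x)\<^sup>2 = (x \<bullet> e) * ((x \<bullet> e) * gauss (2 * k) x)" for x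
    using gauss_mult[of k x k] by (simp add: power2_eq_square mult_ac)
  ultimately show ?thesis
    by (simp add: sq_int_def)
qed

lemma sq_int_gauss:
  assumes "k > 0"
  shows "sq_int lborel (gauss k :: 'a::euclidean_space \<Rightarrow> real)"
  using integrable_gauss[of "2 * k", where 'a = 'a] assms gauss_mult[of k _ k, where 'a = 'a]
  by (simp add: sq_int_def power2_eq_square)

text \<open>The instances h = 1 and h = x \<bullet> d of Gaussian integration by parts.\<close>

lemma gauss_moments:
  fixes d :: "'a::euclidean_space"
  assumes k: "k > 0"
  shows "(\<integral>x. (x \<bullet> d) * gauss k x \<partial>lborel) = 0"
    and "2 * k * (\<integral>x. (x \<bullet> d)\<^sup>2 * gauss k x \<partial>lborel) = (d \<bullet> d) * (\<integral>x. gauss k x \<partial>(lborel :: 'a measure))"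
proof -
  have "(\<integral>x. 0 * gauss k x \<partial>(lborel :: 'a measure)) = 2 * k * (\<integral>x. (x \<bullet> d) * (1 * gauss k x) \<partial>lborel)"
    by (rule gauss_ibp[OF k, where D = "\<lambda>x e. 0" and h = "\<lambda>x. 1"])
       (auto intro: lin_growth_bounded[of _ 1])
  then show "(\<integral>x. (x \<bullet> d) * gauss k x \<partial>lborel) = 0"
    using k by simp
  have "(\<integral>x. (d \<bullet> d) * gauss k x \<partial>(lborel :: 'a measure)) = 2 * k * (\<integral>x. (x \<bullet> d) * ((x \<bullet> d) * gauss k x) \<partial>lborel)"
    by (rule gauss_ibp[OF k, where D = "\<lambda>x e. e \<bullet> d"])
       (auto intro!: derivative_eq_intros lin_growth_inner intro: lin_growth_bounded[of _ "d \<bullet> d"])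
  then show "2 * k * (\<integral>x. (x \<bullet> d)\<^sup>2 * gauss k x \<partial>lborel) = (d \<bullet> d) * (\<integral>x. gauss k x \<partial>(lborel :: 'a measure))"
    by (simp add: power2_eq_square mult.assoc)
qed

text \<open>Square integrability of u comes from the uncertainty principle for the approximating
  functions; after that every term of their inequality converges.\<close>

lemma second_order_hup_limit:
  fixes u :: "'a::euclidean_space \<Rightarrow> real"
  assumes S0: "in_S0 u G"
  shows "sq_int lborel u"
    and "\<And>k. k > 0 \<Longrightarrow> 2 * (\<integral>x. (u x)\<^sup>2 \<partial>lborel) - 2 / (\<integral>x. gauss k x \<partial>(lborel :: 'a measure)) * (\<integral>x. u x * gauss (k / 2) x \<partial>lborel)\<^sup>2
      - 2 * k / (\<integral>x. gauss k x \<partial>(lborel :: 'a measure)) * (\<Sum>i\<in>Basis. (\<integral>x. u x * ((x \<bullet> i) * gauss (k / 2) x) \<partial>lborel)\<^sup>2)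
    \<le> 1 / (2 * k) * (\<integral>x. (norm (G x))\<^sup>2 \<partial>lborel) + k / 2 * (\<integral>x. (u x)\<^sup>2 * (norm x)\<^sup>2 \<partial>lborel)
      - real DIM('a) / 2 * (\<integral>x. (u x)\<^sup>2 \<partial>lborel)"
proof -
  obtain \<phi> D\<phi> where test: "\<And>n. test_fun (\<phi> n)"
    and D\<phi>: "\<And>n x. (\<phi> n has_derivative (\<lambda>h. D\<phi> n x \<bullet> h)) (at x)"
    and limD: "(\<lambda>n. \<integral>x. (norm (D\<phi> n x - G x))\<^sup>2 \<partial>lborel) \<longlonglongrightarrow> 0"
    and limX: "(\<lambda>n. \<integral>x. (\<phi> n x - u x)\<^sup>2 * (norm x)\<^sup>2 \<partial>lborel) \<longlonglongrightarrow> 0"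
    using S0 unfolding in_S0_def by blast
  have [measurable]: "u \<in> borel_measurable borel" "G \<in> borel_measurable borel"
    and Gi: "integrable lborel (\<lambda>x. (norm (G x))\<^sup>2)" and ui: "integrable lborel (\<lambda>x. (u x)\<^sup>2 * (norm x)\<^sup>2)"
    using S0 unfolding in_S0_def by auto
  have \<phi>: "Ckc m (\<phi> n)" for m n
    using test smooth_fun_Ck by (auto simp: Ckc_def test_fun_def)
  have pd\<phi>: "pd i (\<phi> n) x = D\<phi> n x \<bullet> i" for i n x
    by (rule pdI[OF D\<phi>])
  have \<phi>': "Ckc 0 (pd i (\<phi> n))" if "i \<in> Basis" for i n
    using \<phi> that by (rule Ckc_pd)
  have G: "sq_int lborel (\<lambda>x. G x \<bullet> i)" if "i \<in> Basis" for i
  proof -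
    have "(G x \<bullet> i)\<^sup>2 \<le> (norm (G x))\<^sup>2" for x
      using Basis_le_norm[OF that, of "G x"] by (metis abs_le_square_iff abs_norm_cancel)
    then have "integrable lborel (\<lambda>x. (G x \<bullet> i)\<^sup>2)"
      by (intro Bochner_Integration.integrable_bound[OF Gi]) auto
    then show ?thesis
      by (simp add: sq_int_def)
  qed
  have uX: "sq_int lborel (\<lambda>x. u x * norm x)"
    using ui by (simp add: sq_int_def power_mult_distrib)
  \<comment> \<open>Each component of the gradient error is bounded by its norm. Integrability of
    all components is settled before comparing, since a Bochner integral that does not exist is 0 by
    convention.\<close>
  have limD': "(\<lambda>n. \<integral>x. (pd i (\<phi> n) x - G x \<bullet> i)\<^sup>2 \<partial>lborel) \<longlonglongrightarrow> 0" if i: "i \<in> Basis" for i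
  proof (rule tendsto_sandwich[OF _ _ tendsto_const limD]; intro always_eventually allI)
    fix n
    have I: "integrable lborel (\<lambda>x. (pd j (\<phi> n) x - G x \<bullet> j)\<^sup>2)" if "j \<in> Basis" for j
      using sq_int_diff[OF Ckc_sq_int[OF \<phi>'[OF that]] G[OF that]] by (simp add: sq_int_def)
    have eq: "(norm (D\<phi> n x - G x))\<^sup>2 = (\<Sum>j\<in>Basis. (pd j (\<phi> n) x - G x \<bullet> j)\<^sup>2)" for x
      by (simp add: norm_sq_Basis pd\<phi> inner_diff_left)
    show "(\<integral>x. (pd i (\<phi> n) x - G x \<bullet> i)\<^sup>2 \<partial>lborel) \<le> (\<integral>x. (norm (D\<phi> n x - G x))\<^sup>2 \<partial>lborel)"
      unfolding eq using i I by (intro integral_mono member_le_sum) auto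
  qed simp
  have limX': "(\<lambda>n. \<integral>x. (\<phi> n x * norm x - u x * norm x)\<^sup>2 \<partial>lborel) \<longlonglongrightarrow> 0"
    using limX by (simp add: left_diff_distrib[symmetric] power_mult_distrib)
  have um: "u \<in> borel_measurable lborel" by simp
  note approx = Ckc_approx_sq_int[OF \<phi> G um uX limD' limX']
  show u: "sq_int lborel u"
    by (rule approx(1))
  have lim: "(\<lambda>n. \<integral>x. (\<phi> n x - u x)\<^sup>2 \<partial>lborel) \<longlonglongrightarrow> 0"
    by (rule approx(2))
  fix k :: real assume k: "k > 0"
  define Z where "Z = (\<integral>x. gauss k x \<partial>(lborel :: 'a measure))"
  have \<phi>s: "sq_int lborel (\<phi> n)" for n by (rule Ckc_sq_int[OF \<phi>])
  have t1: "(\<lambda>n. \<integral>x. (\<phi> n x)\<^sup>2 \<partial>lborel) \<longlonglongrightarrow> (\<integral>x. (u x)\<^sup>2 \<partial>lborel)"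
    by (rule sq_int_tendsto_sq[OF \<phi>s u lim])
  have t2: "(\<lambda>n. \<integral>x. \<phi> n x * gauss (k / 2) x \<partial>lborel) \<longlonglongrightarrow> (\<integral>x. u x * gauss (k / 2) x \<partial>lborel)"
    using k by (intro sq_int_tendsto_mult[OF \<phi>s u _ lim] sq_int_gauss) auto
  have t3: "(\<lambda>n. \<integral>x. \<phi> n x * ((x \<bullet> i) * gauss (k / 2) x) \<partial>lborel) \<longlonglongrightarrow> (\<integral>x. u x * ((x \<bullet> i) * gauss (k / 2) x) \<partial>lborel)" for i
    using k by (intro sq_int_tendsto_mult[OF \<phi>s u _ lim] sq_int_inner_gauss) auto
  have t4: "(\<lambda>n. \<Sum>i\<in>Basis. \<integral>x. (pd i (\<phi> n) x)\<^sup>2 \<partial>lborel) \<longlonglongrightarrow> (\<integral>x. (norm (G x))\<^sup>2 \<partial>lborel)"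
  proof -
    have "(\<lambda>n. \<Sum>i\<in>Basis. \<integral>x. (pd i (\<phi> n) x)\<^sup>2 \<partial>lborel) \<longlonglongrightarrow> (\<Sum>i\<in>Basis. \<integral>x. (G x \<bullet> i)\<^sup>2 \<partial>lborel)"
      by (intro tendsto_sum sq_int_tendsto_sq limD' G Ckc_sq_int[OF \<phi>'])
    also have "(\<Sum>i\<in>Basis. \<integral>x. (G x \<bullet> i)\<^sup>2 \<partial>lborel) = (\<integral>x. (norm (G x))\<^sup>2 \<partial>lborel)"
      using G by (simp add: norm_sq_Basis sq_int_def)
    finally show ?thesis .
  qed
  have t5: "(\<lambda>n. \<integral>x. (\<phi> n x)\<^sup>2 * (norm x)\<^sup>2 \<partial>lborel) \<longlonglongrightarrow> (\<integral>x. (u x)\<^sup>2 * (norm x)\<^sup>2 \<partial>lborel)"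
    using sq_int_tendsto_sq[OF Ckc_sq_int_norm[OF \<phi>] uX limX'] by (simp add: power_mult_distrib)
  have "2 * (\<integral>x. (u x)\<^sup>2 \<partial>lborel) - 2 / Z * (\<integral>x. u x * gauss (k / 2) x \<partial>lborel)\<^sup>2
      - 2 * k / Z * (\<Sum>i\<in>Basis. (\<integral>x. u x * ((x \<bullet> i) * gauss (k / 2) x) \<partial>lborel)\<^sup>2)
    \<le> 1 / (2 * k) * (\<integral>x. (norm (G x))\<^sup>2 \<partial>lborel) + k / 2 * (\<integral>x. (u x)\<^sup>2 * (norm x)\<^sup>2 \<partial>lborel)
      - real DIM('a) / 2 * (\<integral>x. (u x)\<^sup>2 \<partial>lborel)"
  proof (rule LIMSEQ_le)
    show "(\<lambda>n. 2 * (\<integral>x. (\<phi> n x)\<^sup>2 \<partial>lborel) - 2 / Z * (\<integral>x. \<phi> n x * gauss (k / 2) x \<partial>lborel)\<^sup>2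
      - 2 * k / Z * (\<Sum>i\<in>Basis. (\<integral>x. \<phi> n x * ((x \<bullet> i) * gauss (k / 2) x) \<partial>lborel)\<^sup>2))
      \<longlonglongrightarrow> 2 * (\<integral>x. (u x)\<^sup>2 \<partial>lborel) - 2 / Z * (\<integral>x. u x * gauss (k / 2) x \<partial>lborel)\<^sup>2
      - 2 * k / Z * (\<Sum>i\<in>Basis. (\<integral>x. u x * ((x \<bullet> i) * gauss (k / 2) x) \<partial>lborel)\<^sup>2)"
      by (intro tendsto_diff tendsto_mult tendsto_const tendsto_power tendsto_sum t1 t2 t3)
    show "(\<lambda>n. 1 / (2 * k) * (\<Sum>i\<in>Basis. \<integral>x. (pd i (\<phi> n) x)\<^sup>2 \<partial>lborel) + k / 2 * (\<integral>x. (\<phi> n x)\<^sup>2 * (norm x)\<^sup>2 \<partial>lborel)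
      - real DIM('a) / 2 * (\<integral>x. (\<phi> n x)\<^sup>2 \<partial>lborel))
      \<longlonglongrightarrow> 1 / (2 * k) * (\<integral>x. (norm (G x))\<^sup>2 \<partial>lborel) + k / 2 * (\<integral>x. (u x)\<^sup>2 * (norm x)\<^sup>2 \<partial>lborel)
      - real DIM('a) / 2 * (\<integral>x. (u x)\<^sup>2 \<partial>lborel)"
      by (intro tendsto_diff tendsto_add tendsto_mult tendsto_const t1 t4 t5)
    show "\<exists>N. \<forall>n\<ge>N. 2 * (\<integral>x. (\<phi> n x)\<^sup>2 \<partial>lborel) - 2 / Z * (\<integral>x. \<phi> n x * gauss (k / 2) x \<partial>lborel)\<^sup>2
      - 2 * k / Z * (\<Sum>i\<in>Basis. (\<integral>x. \<phi> n x * ((x \<bullet> i) * gauss (k / 2) x) \<partial>lborel)\<^sup>2)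
      \<le> 1 / (2 * k) * (\<Sum>i\<in>Basis. \<integral>x. (pd i (\<phi> n) x)\<^sup>2 \<partial>lborel) + k / 2 * (\<integral>x. (\<phi> n x)\<^sup>2 * (norm x)\<^sup>2 \<partial>lborel)
      - real DIM('a) / 2 * (\<integral>x. (\<phi> n x)\<^sup>2 \<partial>lborel)"
      unfolding Z_def using second_order_hup_Ckc[OF k \<phi>] by blast
  qed
  then show "2 * (\<integral>x. (u x)\<^sup>2 \<partial>lborel) - 2 / (\<integral>x. gauss k x \<partial>(lborel :: 'a measure)) * (\<integral>x. u x * gauss (k / 2) x \<partial>lborel)\<^sup>2
      - 2 * k / (\<integral>x. gauss k x \<partial>(lborel :: 'a measure)) * (\<Sum>i\<in>Basis. (\<integral>x. u x * ((x \<bullet> i) * gauss (k / 2) x) \<partial>lborel)\<^sup>2)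
    \<le> 1 / (2 * k) * (\<integral>x. (norm (G x))\<^sup>2 \<partial>lborel) + k / 2 * (\<integral>x. (u x)\<^sup>2 * (norm x)\<^sup>2 \<partial>lborel)
      - real DIM('a) / 2 * (\<integral>x. (u x)\<^sup>2 \<partial>lborel)"
    unfolding Z_def .
qed

text \<open>The coefficients \<open>c\<close> and \<open>d\<close> are those of the orthogonal projection of \<open>u\<close> onto the Hermite
  functions of degree at most one.\<close>

lemma projection_distances:
  fixes u :: "'a::euclidean_space \<Rightarrow> real"
  assumes k: "k > 0" and u: "sq_int lborel u"
  defines "Z \<equiv> (\<integral>x. gauss k x \<partial>(lborel :: 'a measure))"
    and "b \<equiv> (\<integral>x. u x * gauss (k / 2) x \<partial>lborel)"
    and "s \<equiv> \<lambda>i. (\<integral>x. u x * ((x \<bullet> i) * gauss (k / 2) x) \<partial>lborel)"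
  defines "c \<equiv> b / Z" and "d \<equiv> (\<Sum>i\<in>Basis. (2 * k / Z * s i) *\<^sub>R i)"
  shows "(\<integral>x. (u x - c * gauss (k / 2) x)\<^sup>2 \<partial>lborel) = (\<integral>x. (u x)\<^sup>2 \<partial>lborel) - b\<^sup>2 / Z"
    and "(\<integral>x. (u x - (c + d \<bullet> x) * gauss (k / 2) x)\<^sup>2 \<partial>lborel)
      = (\<integral>x. (u x)\<^sup>2 \<partial>lborel) - b\<^sup>2 / Z - 2 * k / Z * (\<Sum>i\<in>Basis. (s i)\<^sup>2)"
proof -
  let ?\<gamma> = "gauss (k / 2) :: 'a \<Rightarrow> real"
  have Z: "Z > 0"
    unfolding Z_def by (rule integral_gauss_pos[OF k])
  have k2: "k / 2 > 0" using k by simp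
  have gg: "?\<gamma> x * ?\<gamma> x = gauss k x" for x
    by (simp add: gauss_mult)
  have I: "integrable lborel (\<lambda>x. (u x)\<^sup>2)" "integrable lborel (\<lambda>x. u x * ?\<gamma> x)"
    "integrable lborel (\<lambda>x. u x * ((x \<bullet> e) * ?\<gamma> x))"
    "integrable lborel (gauss k :: 'a \<Rightarrow> real)"
    "integrable lborel (\<lambda>x. (x \<bullet> e) * gauss k x)"
    "integrable lborel (\<lambda>x. (x \<bullet> e)\<^sup>2 * gauss k x)" for e
  proof -
    show "integrable lborel (\<lambda>x. (x \<bullet> e) * gauss k x)"
      using k by (intro gdom_integrable gdom_mult_lin_growth lin_growth_inner gdom_gauss) auto
    have "integrable lborel (\<lambda>x. (x \<bullet> e) * ((x \<bullet> e) * gauss k x))"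
      using k by (intro gdom_integrable gdom_mult_lin_growth lin_growth_inner gdom_gauss) auto
    then show "integrable lborel (\<lambda>x. (x \<bullet> e)\<^sup>2 * gauss k x)"
      by (simp add: power2_eq_square mult.assoc)
  qed (use u k in \<open>auto simp: sq_int_def intro!: sq_int_mult[OF u] sq_int_gauss sq_int_inner_gauss integrable_gauss\<close>)
  \<comment> \<open>Stated for arbitrary d with c already fixed. The odd Gaussian moment vanishes,
    so the corrections by c and by d decouple; d = 0 gives the first claim.\<close>
  have general: "(\<integral>x. (u x - (c + d \<bullet> x) * ?\<gamma> x)\<^sup>2 \<partial>lborel) = (\<integral>x. (u x)\<^sup>2 \<partial>lborel) - 2 * c * b
      - 2 * (\<integral>x. u x * ((x \<bullet> d) * ?\<gamma> x) \<partial>lborel) + c\<^sup>2 * Z + (d \<bullet> d) * Z / (2 * k)" for d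
  proof -
    have "(u x - (c + d \<bullet> x) * ?\<gamma> x)\<^sup>2 = (u x)\<^sup>2 - 2 * c * (u x * ?\<gamma> x) - 2 * (u x * ((x \<bullet> d) * ?\<gamma> x))
        + c\<^sup>2 * (?\<gamma> x * ?\<gamma> x) + 2 * c * ((x \<bullet> d) * (?\<gamma> x * ?\<gamma> x)) + (x \<bullet> d)\<^sup>2 * (?\<gamma> x * ?\<gamma> x)" for x
      by (simp add: power2_eq_square inner_commute[of d] algebra_simps)
    then have "(\<integral>x. (u x - (c + d \<bullet> x) * ?\<gamma> x)\<^sup>2 \<partial>lborel) = (\<integral>x. (u x)\<^sup>2 - 2 * c * (u x * ?\<gamma> x) - 2 * (u x * ((x \<bullet> d) * ?\<gamma> x))
        + c\<^sup>2 * gauss k x + 2 * c * ((x \<bullet> d) * gauss k x) + (x \<bullet> d)\<^sup>2 * gauss k x \<partial>lborel)"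
      unfolding gg by simp
    also have "\<dots> = (\<integral>x. (u x)\<^sup>2 \<partial>lborel) - 2 * c * b - 2 * (\<integral>x. u x * ((x \<bullet> d) * ?\<gamma> x) \<partial>lborel)
        + c\<^sup>2 * Z + 2 * c * (\<integral>x. (x \<bullet> d) * gauss k x \<partial>lborel) + (\<integral>x. (x \<bullet> d)\<^sup>2 * gauss k x \<partial>lborel)"
      unfolding Z_def b_def using I by simp
    also have "(\<integral>x. (x \<bullet> d)\<^sup>2 * gauss k x \<partial>lborel) = (d \<bullet> d) * Z / (2 * k)"
      using gauss_moments(2)[OF k, of d] k by (simp add: Z_def field_simps)
    finally show ?thesis
      by (simp add: gauss_moments(1)[OF k])
  qed
  have cb: "- 2 * c * b + c\<^sup>2 * Z = - b\<^sup>2 / Z"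
    using Z by (simp add: c_def field_simps power2_eq_square)
  show "(\<integral>x. (u x - c * ?\<gamma> x)\<^sup>2 \<partial>lborel) = (\<integral>x. (u x)\<^sup>2 \<partial>lborel) - b\<^sup>2 / Z"
    using general[of 0] cb by simp
  have xd: "x \<bullet> d = (\<Sum>i\<in>Basis. 2 * k / Z * s i * (x \<bullet> i))" for x
    by (simp add: d_def inner_sum_right)
  have "d \<bullet> d = (\<Sum>i\<in>Basis. (2 * k / Z * s i)\<^sup>2)"
    unfolding xd by (intro sum.cong refl) (simp add: d_def power2_eq_square)
  then have dd: "d \<bullet> d = (2 * k / Z)\<^sup>2 * (\<Sum>i\<in>Basis. (s i)\<^sup>2)"
    by (simp only: power_mult_distrib sum_distrib_left)
  have ud: "(\<integral>x. u x * ((x \<bullet> d) * ?\<gamma> x) \<partial>lborel) = 2 * k / Z * (\<Sum>i\<in>Basis. (s i)\<^sup>2)"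
  proof -
    have "u x * ((x \<bullet> d) * ?\<gamma> x) = (\<Sum>i\<in>Basis. 2 * k / Z * s i * (u x * ((x \<bullet> i) * ?\<gamma> x)))" for x
      unfolding xd sum_distrib_left sum_distrib_right by (intro sum.cong refl) (simp only: mult_ac)
    then have "(\<integral>x. u x * ((x \<bullet> d) * ?\<gamma> x) \<partial>lborel) = (\<Sum>i\<in>Basis. 2 * k / Z * s i * s i)"
      using I(3) by (simp add: s_def)
    then show ?thesis
      by (simp add: sum_distrib_left power2_eq_square mult.assoc)
  qed
  have "(d \<bullet> d) * Z / (2 * k) = 2 * k / Z * (\<Sum>i\<in>Basis. (s i)\<^sup>2)"
    unfolding dd using Z k by (simp add: field_simps power2_eq_square)
  then show "(\<integral>x. (u x - (c + d \<bullet> x) * ?\<gamma> x)\<^sup>2 \<partial>lborel)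
      = (\<integral>x. (u x)\<^sup>2 \<partial>lborel) - b\<^sup>2 / Z - 2 * k / Z * (\<Sum>i\<in>Basis. (s i)\<^sup>2)"
    using general[of d] cb ud by simp
qed

text \<open>The left side of \<open>second_order_hup_limit\<close> is the sum of the two squared
  distances: the degree-0 correction b^2 / Z occurs in both of them, the degree-1 correction in
  one.\<close>

lemma weighted_deficit_bound:
  fixes u :: "'a::euclidean_space \<Rightarrow> real"
  assumes S0: "in_S0 u G" and k: "k > 0"
  shows "\<exists>c d. (\<integral>x. (u x - c * gauss (k / 2) x)\<^sup>2 \<partial>lborel) + (\<integral>x. (u x - (c + d \<bullet> x) * gauss (k / 2) x)\<^sup>2 \<partial>lborel)
    \<le> 1 / (2 * k) * (\<integral>x. (norm (G x))\<^sup>2 \<partial>lborel) + k / 2 * (\<integral>x. (u x)\<^sup>2 * (norm x)\<^sup>2 \<partial>lborel)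
      - real DIM('a) / 2 * (\<integral>x. (u x)\<^sup>2 \<partial>lborel)"
  using second_order_hup_limit(2)[OF S0 k]
  by (intro exI, subst projection_distances(1)[OF k second_order_hup_limit(1)[OF S0]],
      subst projection_distances(2)[OF k second_order_hup_limit(1)[OF S0]]) simp

text \<open>For positive a and b the minimum of a^2 / (2 k) + k b^2 / 2 over k > 0 is a b, attained
  at k = a / b.\<close>

lemma deficit_bound:
  fixes u :: "'a::euclidean_space \<Rightarrow> real"
  assumes S0: "in_S0 u G"
  shows "\<exists>k>0. \<exists>c d. (\<integral>x. (u x - c * gauss (k / 2) x)\<^sup>2 \<partial>lborel)
    + (\<integral>x. (u x - (c + d \<bullet> x) * gauss (k / 2) x)\<^sup>2 \<partial>lborel) \<le> delta1 u G"
proof -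
  define a where "a = sqrt (\<integral>x. (norm (G x))\<^sup>2 \<partial>lborel)"
  define b where "b = sqrt (\<integral>x. (u x)\<^sup>2 * (norm x)\<^sup>2 \<partial>lborel)"
  define A where "A = (\<integral>x. (u x)\<^sup>2 \<partial>lborel)"
  have ab: "a \<ge> 0" "b \<ge> 0" "a\<^sup>2 = (\<integral>x. (norm (G x))\<^sup>2 \<partial>lborel)" "b\<^sup>2 = (\<integral>x. (u x)\<^sup>2 * (norm x)\<^sup>2 \<partial>lborel)"
    and A: "A \<ge> 0"
    by (auto simp: a_def b_def A_def)
  have delta: "delta1 u G = a * b - real DIM('a) / 2 * A"
    by (simp add: delta1_def a_def b_def A_def)
  have bound: "\<exists>c d. (\<integral>x. (u x - c * gauss (k / 2) x)\<^sup>2 \<partial>lborel)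
    + (\<integral>x. (u x - (c + d \<bullet> x) * gauss (k / 2) x)\<^sup>2 \<partial>lborel) \<le> a\<^sup>2 / (2 * k) + k / 2 * b\<^sup>2 - real DIM('a) / 2 * A"
    if "k > 0" for k
    using weighted_deficit_bound[OF S0 that] unfolding ab(3)[symmetric] ab(4)[symmetric] A_def[symmetric] by simp
  show ?thesis
  proof (cases "a = 0 \<or> b = 0")
    case False
    then have "a > 0" "b > 0" using ab by auto
    then have k: "a / b > 0" and eq: "a\<^sup>2 / (2 * (a / b)) + (a / b) / 2 * b\<^sup>2 = a * b"
      by (auto simp: field_simps power2_eq_square)
    show ?thesis
      using k bound[OF k] unfolding delta eq by blast
  next
    case True
    \<comment> \<open>Here the right side of \<open>bound\<close> without its last term can be made
      arbitrarily small, so nonnegativity of the squared distances forces A = 0.\<close>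
    have "A = 0"
    proof (rule ccontr)
      assume "A \<noteq> 0"
      then have "A > 0" using A by simp
      have D: "real DIM('a) \<ge> 1"
        using DIM_positive[where 'a = 'a] by (simp add: Suc_le_eq)
      have le: "real DIM('a) / 2 * A \<le> a\<^sup>2 / (2 * k) + k / 2 * b\<^sup>2" if k: "k > 0" for k
      proof -
        obtain c d where cd: "(\<integral>x. (u x - c * gauss (k / 2) x)\<^sup>2 \<partial>lborel)
          + (\<integral>x. (u x - (c + d \<bullet> x) * gauss (k / 2) x)\<^sup>2 \<partial>lborel) \<le> a\<^sup>2 / (2 * k) + k / 2 * b\<^sup>2 - real DIM('a) / 2 * A"
          using bound[OF k] by blast
        have "0 \<le> (\<integral>x. (u x - c * gauss (k / 2) x)\<^sup>2 \<partial>lborel)" "0 \<le> (\<integral>x. (u x - (c + d \<bullet> x) * gauss (k / 2) x)\<^sup>2 \<partial>lborel)"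
          by simp_all
        then show ?thesis using cd by linarith
      qed
      have "1 / 2 * A \<le> real DIM('a) / 2 * A"
        using D \<open>A > 0\<close> by (intro mult_right_mono) auto
      then have le': "A \<le> a\<^sup>2 / k + k * b\<^sup>2" if "k > 0" for k
        using le[OF that] by simp
      show False
      proof (cases "a = 0")
        case True
        \<comment> \<open>With a = 0 the choice of k keeps k b^2 at most A / 2; the 1 in the
          denominator covers b = 0.\<close>
        have "A \<le> A / (1 + b\<^sup>2) * b\<^sup>2 / 2"
          using le'[of "A / (1 + b\<^sup>2) / 2"] True \<open>A > 0\<close> by (simp add: add_pos_nonneg)
        also have "\<dots> \<le> A / 2"
          using \<open>A > 0\<close> by (simp add: field_simps add_pos_nonneg)
        finally show False using \<open>A > 0\<close> by simp
      next
        case False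
        then have "b = 0" using \<open>a = 0 \<or> b = 0\<close> by simp
        \<comment> \<open>With b = 0 the choice of k makes a^2 / k equal to A / 2.\<close>
        then have "A \<le> a\<^sup>2 / (2 * a\<^sup>2 / A)"
          using le'[of "2 * a\<^sup>2 / A"] False \<open>A > 0\<close> by simp
        also have "\<dots> = A / 2"
          using False by simp
        finally show False using \<open>A > 0\<close> by simp
      qed
    qed
    \<comment> \<open>Both sides are 0: with c = 0 and d = 0 each integral is A, and the product a b
      vanishes. Any k would do, and k = 1 is taken.\<close>
    then have "(\<integral>x. (u x - 0 * gauss (1 / 2) x)\<^sup>2 \<partial>lborel) + (\<integral>x. (u x - (0 + 0 \<bullet> x) * gauss (1 / 2) x)\<^sup>2 \<partial>lborel) \<le> delta1 u G"
      unfolding delta using True by (auto simp: A_def)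
    then show ?thesis
      by (intro exI[of _ 1] conjI exI[of _ 0]) auto
  qed
qed

text \<open>The infimum of nonnegative numbers is nonnegative, so squaring preserves the bound; v
  makes the set nonempty, as \<open>Inf\<close> on the reals requires.\<close>

lemma d1_square_le:
  assumes "v \<in> B"
  shows "(d1 u B)\<^sup>2 \<le> (\<integral>x. (u x - v x)\<^sup>2 \<partial>lborel)"
proof -
  let ?S = "{sqrt (\<integral>x. (u x - v x)\<^sup>2 \<partial>lborel) | v. v \<in> B}"
  have "0 \<le> d1 u B"
    unfolding d1_def using assms by (intro cInf_greatest) auto
  moreover have "d1 u B \<le> sqrt (\<integral>x. (u x - v x)\<^sup>2 \<partial>lborel)"
    unfolding d1_def using assms by (intro cInf_lower bdd_belowI[of _ 0]) auto
  ultimately have "(d1 u B)\<^sup>2 \<le> (sqrt (\<integral>x. (u x - v x)\<^sup>2 \<partial>lborel))\<^sup>2"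
    by (intro power_mono)
  then show ?thesis by simp
qed

lemma d2F_square_le:
  assumes "lam \<noteq> 0"
  shows "(d2F u)\<^sup>2 \<le> (\<integral>x. (u x - c * exp (- (norm x)\<^sup>2 / (2 * lam\<^sup>2)))\<^sup>2
       + (u x - (c + d \<bullet> x) * exp (- (norm x)\<^sup>2 / (2 * lam\<^sup>2)))\<^sup>2 \<partial>lborel)" (is "_ \<le> ?I")
proof -
  have "0 \<le> d2F u"
    unfolding d2F_def using assms by (intro cInf_greatest) auto
  moreover have "d2F u \<le> sqrt ?I"
    unfolding d2F_def using assms by (intro cInf_lower bdd_belowI[of _ 0]) auto
  ultimately have "(d2F u)\<^sup>2 \<le> (sqrt ?I)\<^sup>2"
    by (intro power_mono)
  then show ?thesis by simp
qed

theorem theorem1p12: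
  fixes u :: "'a::euclidean_space \<Rightarrow> real" and G :: "'a \<Rightarrow> 'a"
  assumes "in_S0 u G"
  shows "delta1 u G \<ge> (d2F u)\<^sup>2 \<and>
           delta1 u G - (d1 u E_HUP)\<^sup>2 \<ge> (d1 u F_set)\<^sup>2"
proof -
  obtain k c and d :: 'a where k: "k > 0" and le: "(\<integral>x. (u x - c * gauss (k / 2) x)\<^sup>2 \<partial>lborel)
    + (\<integral>x. (u x - (c + d \<bullet> x) * gauss (k / 2) x)\<^sup>2 \<partial>lborel) \<le> delta1 u G"
    using deficit_bound[OF assms] by blast
  have u: "sq_int lborel u"
    by (rule second_order_hup_limit(1)[OF assms])
  have g: "sq_int lborel (gauss (k / 2) :: 'a \<Rightarrow> real)" "sq_int lborel (\<lambda>x::'a. (x \<bullet> d) * gauss (k / 2) x)"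
    using k by (auto intro: sq_int_gauss sq_int_inner_gauss)
  have "sq_int lborel (\<lambda>x. u x - c * gauss (k / 2) x)"
    by (intro sq_int_diff sq_int_cmult u g)
  moreover have "sq_int lborel (\<lambda>x. u x - (c * gauss (k / 2) x + (x \<bullet> d) * gauss (k / 2) x))"
    by (intro sq_int_diff sq_int_add sq_int_cmult u g)
  \<comment> \<open>\<open>d2F\<close> has one integral of a sum; splitting it needs both integrands
    to be integrable.\<close>
  ultimately have I: "integrable lborel (\<lambda>x. (u x - c * gauss (k / 2) x)\<^sup>2)"
    "integrable lborel (\<lambda>x. (u x - (c + d \<bullet> x) * gauss (k / 2) x)\<^sup>2)"
    by (auto simp: sq_int_def distrib_right inner_commute)
  \<comment> \<open>The scale at which the Gaussian in \<open>d2F\<close> becomes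
    \<open>gauss (k / 2)\<close>.\<close>
  have lam: "1 / sqrt k \<noteq> 0" using k by simp
  have eq: "exp (- (norm x)\<^sup>2 / (2 * (1 / sqrt k)\<^sup>2)) = gauss (k / 2) x" for x :: 'a
    using k by (simp add: gauss_def power_divide)
  have "(d2F u)\<^sup>2 \<le> delta1 u G"
    using d2F_square_le[OF lam, of u c d] le I unfolding eq by simp
  \<comment> \<open>Both projections are admissible competitors, so the two summands bound the
    squares of the two distances separately.\<close>
  moreover have "(\<lambda>x. c * gauss (k / 2) x) \<in> E_HUP" "(\<lambda>x. (c + d \<bullet> x) * gauss (k / 2) x) \<in> F_set"
    unfolding E_HUP_def F_set_def gauss_def using half_gt_zero[OF k] by blast+
  ultimately show ?thesis
    using d1_square_le[of _ E_HUP u] d1_square_le[of _ F_set u] le by fastforce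
qed

end
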